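(* Let $1\le k\le n$ be integers and write $k = \rho n$ with $\rho\in(0,1]$. Let $Q$ be uniformly distributed on the Stiefel manifold $\mathbb{V}_k^n$, and let $G\in\mathbb{M}^{n\times k}$ be a normalized Gaussian matrix. Then for each right operator ideal norm $\vert\!\vert\!\vert\cdot\vert\!\vert\!\vert$, $$\mathbb{E}\,\vert\!\vert\!\vert G \vert\!\vert\!\vert \le (1+\sqrt{\rho})\cdot \mathbb{E}\,\vert\!\vert\!\vert Q\vert\!\vert\!\vert.$$
   Context: $\mathbb{M}^{n\times k}$ is the space of real $n\times k$ matrices. The Stiefel manifold is $\mathbb{V}_k^n := \{Q\in\mathbb{M}^{n\times k} : Q^*Q=\mathrm{I}\}$; "uniformly distributed" means distributed according to the Haar probability measure on $\mathbb{V}_k^n$, invariant under orthogonal transformations on the left and the right. A normalized Gaussian matrix in $\mathbb{M}^{n\times k}$ has independent $\mathrm{N}(0,n^{-1})$ entries (mean zero, variance $n^{-1}$). A right operator ideal norm is a norm $\vert\!\vert\!\vert\cdot\vert\!\vert\!\vert$ (here on $\mathbb{M}^{n\times k}$) satisfying $\vert\!\vert\!\vert AB\vert\!\vert\!\vert \le \vert\!\vert\!\vert A\vert\!\vert\!\vert\cdot\Vert B\Vert$ for all $A\in\mathbb{M}^{n\times k}$ and $B\in\mathbb{M}^{k\times k}$, where $\Vert\cdot\Vert$ is the spectral norm (the $\ell_2\to\ell_2$ operator norm). *)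

theory Defs
  imports "HOL-Probability.Probability"
begin

text \<open>Real \<open>n \<times> k\<close> matrices are elements of \<^typ>\<open>real ^ 'k ^ 'n\<close> with \<open>n = CARD('n)\<close> and
  \<open>k = CARD('k)\<close>.\<close>

definition stiefel :: "(real ^ 'k ^ 'n) set" where
  "stiefel = {Q. transpose Q ** Q = mat 1}"

text \<open>The Haar measure is described by its defining property: it is the (unique) Borel probability
  measure on the Stiefel manifold that is invariant under the two-sided orthogonal action.\<close>

definition haar_stiefel :: "(real ^ 'k ^ 'n) measure \<Rightarrow> bool" where
  "haar_stiefel \<mu> \<longleftrightarrow>
     prob_space \<mu> \<and> sets \<mu> = sets (restrict_space borel stiefel) \<and>
     (\<forall>(U :: real ^ 'n ^ 'n) (V :: real ^ 'k ^ 'k).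
        orthogonal_matrix U \<longrightarrow> orthogonal_matrix V \<longrightarrow> distr \<mu> \<mu> (\<lambda>X. U ** X ** V) = \<mu>)"

definition uniform_on_stiefel :: "'a measure \<Rightarrow> ('a \<Rightarrow> real ^ 'k ^ 'n) \<Rightarrow> bool" where
  "uniform_on_stiefel M Q \<longleftrightarrow>
     Q \<in> measurable M (restrict_space borel stiefel) \<and>
     haar_stiefel (distr M (restrict_space borel stiefel) Q)"

text \<open>The second parameter of \<^const>\<open>normal_density\<close> is the standard deviation, so variance
  \<open>1 / n\<close> corresponds to \<open>1 / sqrt n\<close>.\<close>

definition normalized_gaussian :: "'a measure \<Rightarrow> ('a \<Rightarrow> real ^ 'k ^ 'n) \<Rightarrow> bool" where
  "normalized_gaussian M G \<longleftrightarrow>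
     prob_space.indep_vars M (\<lambda>_. borel) (\<lambda>(i, j) \<omega>. G \<omega> $ i $ j) (UNIV :: ('n \<times> 'k) set) \<and>
     (\<forall>i j. distributed M lborel (\<lambda>\<omega>. G \<omega> $ i $ j)
              (normal_density 0 (1 / sqrt (real CARD('n)))))"

definition is_norm :: "('v::real_vector \<Rightarrow> real) \<Rightarrow> bool" where
  "is_norm N \<longleftrightarrow>
     (\<forall>x. N x = 0 \<longleftrightarrow> x = 0) \<and>
     (\<forall>x y. N (x + y) \<le> N x + N y) \<and>
     (\<forall>c x. N (c *\<^sub>R x) = \<bar>c\<bar> * N x)"

definition spectral_norm :: "real ^ 'm ^ 'n \<Rightarrow> real" where
  "spectral_norm B = onorm ((*v) B)"

definition right_operator_ideal_norm :: "(real ^ 'k ^ 'n \<Rightarrow> real) \<Rightarrow> bool" where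
  "right_operator_ideal_norm N \<longleftrightarrow>
     is_norm N \<and>
     (\<forall>(A :: real ^ 'k ^ 'n) (B :: real ^ 'k ^ 'k). N (A ** B) \<le> N A * spectral_norm B)"

end

theory Submission
  imports Defs
begin

text \<open>The argument has two halves.

  \<^item> Every \<open>n \<times> k\<close> matrix factors as \<open>X = P R\<close> with \<open>P\<close> in the Stiefel manifold and
  \<open>\<parallel>R\<parallel> = \<parallel>X\<parallel>\<close>. Maak's averaging argument yields, for every \<open>\<epsilon> > 0\<close>, a function \<open>f\<close> that is
  a repeated average of left translates \<open>X \<mapsto> N (U X)\<close>, \<open>U\<close> orthogonal, and satisfies
  \<open>f P \<le> E N(Q) + \<epsilon>\<close> for all \<open>P\<close> in the Stiefel manifold. Left translation preserves the law of \<open>G\<close>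
  and the ideal property, so \<open>E N(G) = E f(G) \<le> (E N(Q) + \<epsilon>) E \<parallel>G\<parallel>\<close>. Neither a Haar measure on the
  orthogonal group nor the uniqueness of the uniform distribution is needed.

  \<^item> \<open>E \<parallel>G\<parallel> \<le> 1 + sqrt \<rho>\<close> is Chevet's inequality. It follows from the Sudakov--Fernique comparison of
  \<open>v \<bullet> G u\<close> with \<open>v \<bullet> g + u \<bullet> h\<close>. The comparison is proved for the smooth maximum
  \<open>ln (\<Sum>t. exp (c t))\<close> by a Lindeberg replacement: split both Gaussian vectors into \<open>m\<close> independent
  pieces of variance \<open>1 / m\<close> and exchange them one by one. By Taylor's formula an exchange of one piece
  changes the expectation by a term of the right sign of order \<open>1 / m\<close>, up to an error of
  order \<open>m powr (-3/2)\<close>.\<close>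

section \<open>The standard Gaussian measure\<close>

text \<open>Given as a density over \<open>Basis\<close> rather than as a product of measures, so
  that vectors, matrices and pairs of Euclidean spaces are all covered by one definition.\<close>

definition std_gaussian :: "'a::euclidean_space measure" where
  "std_gaussian = density lborel (\<lambda>x. \<Prod>b\<in>Basis. ennreal (std_normal_density (x \<bullet> b)))"

lemma space_std_gaussian [simp]: "space std_gaussian = UNIV"
  and sets_std_gaussian [simp, measurable_cong]: "sets std_gaussian = sets borel"
  by (simp_all add: std_gaussian_def)

lemma prob_space_std_normal_distribution: "prob_space std_normal_distribution"
  by (rule prob_space_normal_density) simp

text \<open>Independence of the coordinates: the density is a product over \<open>Basis\<close>, and
  Lebesgue measure turns integrals of such products into products of integrals.\<close>

lemma nn_integral_std_gaussian_prod:
  fixes f :: "'a::euclidean_space \<Rightarrow> real \<Rightarrow> ennreal"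
  assumes [measurable]: "\<And>b. b \<in> Basis \<Longrightarrow> f b \<in> borel_measurable borel"
  shows "(\<integral>\<^sup>+x. (\<Prod>b\<in>Basis. f b (x \<bullet> b)) \<partial>std_gaussian)
         = (\<Prod>b\<in>Basis. \<integral>\<^sup>+t. f b t \<partial>std_normal_distribution)"
proof -
  have "(\<integral>\<^sup>+x. (\<Prod>b\<in>Basis. f b (x \<bullet> b)) \<partial>std_gaussian)
      = (\<integral>\<^sup>+x. (\<Prod>b\<in>Basis. ennreal (std_normal_density (x \<bullet> b)) * f b (x \<bullet> b)) \<partial>lborel)"
    unfolding std_gaussian_def by (subst nn_integral_density) (auto simp: prod.distrib)
  also have "\<dots> = (\<Prod>b\<in>Basis. \<integral>\<^sup>+t. ennreal (std_normal_density t) * f b t \<partial>lborel)"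
    by (rule nn_integral_lborel_prod) auto
  also have "\<dots> = (\<Prod>b\<in>Basis. \<integral>\<^sup>+t. f b t \<partial>std_normal_distribution)"
    by (intro prod.cong refl nn_integral_density[symmetric]) auto
  finally show ?thesis .
qed

lemma prob_space_std_gaussian: "prob_space (std_gaussian :: 'a::euclidean_space measure)"
proof
  interpret N: prob_space std_normal_distribution by (rule prob_space_std_normal_distribution)
  show "emeasure (std_gaussian :: 'a measure) (space std_gaussian) = 1"
    using nn_integral_std_gaussian_prod[of "\<lambda>_ _. 1" ] N.emeasure_space_1 by simp
qed

interpretation std_gaussian: prob_space "std_gaussian :: 'a::euclidean_space measure"
  by (rule prob_space_std_gaussian)

lemma nn_integral_std_gaussian_coord:
  fixes b :: "'a::euclidean_space"
  assumes b: "b \<in> Basis" and [measurable]: "f \<in> borel_measurable borel"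
  shows "(\<integral>\<^sup>+x. f (x \<bullet> b) \<partial>std_gaussian) = (\<integral>\<^sup>+t. f t \<partial>std_normal_distribution)"
proof -
  interpret N: prob_space std_normal_distribution by (rule prob_space_std_normal_distribution)
  \<comment> \<open>The constant factor 1 at every other basis vector integrates to 1, so only the
    factor at \<open>b\<close> survives in the product formula.\<close>
  define g where "g = (\<lambda>c t. if c = b then f t else 1)"
  have g: "(\<Prod>c\<in>Basis. g c (h c)) = f (h b)" for h :: "'a \<Rightarrow> real"
    using b by (simp add: g_def prod.delta' if_distrib cong: if_cong)
  have "(\<integral>\<^sup>+x. (\<Prod>c\<in>Basis. g c (x \<bullet> c)) \<partial>std_gaussian)
         = (\<Prod>c\<in>Basis. \<integral>\<^sup>+t. g c t \<partial>std_normal_distribution)"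
    by (rule nn_integral_std_gaussian_prod) (auto simp: g_def)
  also have "\<dots> = (\<Prod>c\<in>Basis. if c = b then \<integral>\<^sup>+t. f t \<partial>std_normal_distribution else 1)"
    using N.emeasure_space_1 by (intro prod.cong) (auto simp: g_def)
  also have "\<dots> = (\<integral>\<^sup>+t. f t \<partial>std_normal_distribution)"
    using b by (simp add: prod.delta')
  finally show ?thesis by (simp add: g)
qed

lemma distr_std_gaussian_coord:
  fixes b :: "'a::euclidean_space"
  assumes b: "b \<in> Basis"
  shows "distr std_gaussian borel (\<lambda>x. x \<bullet> b) = std_normal_distribution"
proof (rule measure_eqI)
  fix A assume "A \<in> sets (distr std_gaussian borel (\<lambda>x::'a. x \<bullet> b))"
  then have [measurable]: "A \<in> sets borel" by simp
  have "emeasure (distr std_gaussian borel (\<lambda>x::'a. x \<bullet> b)) A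
      = (\<integral>\<^sup>+x. indicator A (x \<bullet> b) \<partial>std_gaussian)"
    by (subst nn_integral_indicator[symmetric], simp, subst nn_integral_distr) auto
  also have "\<dots> = (\<integral>\<^sup>+t. indicator A t \<partial>std_normal_distribution)"
    by (rule nn_integral_std_gaussian_coord[OF b]) simp
  also have "\<dots> = emeasure std_normal_distribution A" by simp
  finally show "emeasure (distr std_gaussian borel (\<lambda>x::'a. x \<bullet> b)) A = emeasure std_normal_distribution A" .
qed simp

section \<open>Moments of the standard Gaussian measure\<close>

lemma std_gaussian_coord_moment2:
  fixes b :: "'a::euclidean_space"
  assumes b: "b \<in> Basis"
  shows "has_bochner_integral std_gaussian (\<lambda>x. (x \<bullet> b)\<^sup>2) 1"
proof -
  have I: "integrable std_normal_distribution (\<lambda>x. x^2)"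
    using std_normal_distribution_even_moments(2)[of 1] by simp
  have L: "(LINT x|std_normal_distribution. x^2) = 1"
    using std_normal_distribution_even_moments(1)[of 1] by (simp add: fact_2)
  have "integrable std_gaussian (\<lambda>x. (x \<bullet> b)\<^sup>2)"
    using I unfolding distr_std_gaussian_coord[OF b, symmetric] by (subst (asm) integrable_distr_eq) auto
  moreover have "(LINT x|std_gaussian. (x \<bullet> b)\<^sup>2) = 1"
    using L unfolding distr_std_gaussian_coord[OF b, symmetric] by (subst (asm) integral_distr) auto
  ultimately show ?thesis by (simp add: has_bochner_integral_iff)
qed

lemma std_gaussian_coord_moment4:
  fixes b :: "'a::euclidean_space"
  assumes b: "b \<in> Basis"
  shows "integrable std_gaussian (\<lambda>x. (x \<bullet> b)^4)"
proof -
  have I: "integrable std_normal_distribution (\<lambda>x. x^4)"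
    using std_normal_distribution_even_moments(2)[of 2] by simp
  then show ?thesis
    unfolding distr_std_gaussian_coord[OF b, symmetric] by (subst (asm) integrable_distr_eq) auto
qed

lemma norm_sq_Basis: "(norm (x::'a::euclidean_space))\<^sup>2 = (\<Sum>b\<in>Basis. (x \<bullet> b)\<^sup>2)"
  by (subst power2_norm_eq_inner, subst euclidean_inner) (simp add: power2_eq_square)

text \<open>Cauchy-Schwarz on the sum of squared coordinates reduces this to one-dimensional fourth
  moments. It dominates all powers of the norm that occur later, in particular the cubic Taylor
  remainder.\<close>

lemma std_gaussian_norm4: "integrable std_gaussian (\<lambda>x::'a::euclidean_space. (norm x)^4)"
proof (rule Bochner_Integration.integrable_bound)
  show "integrable std_gaussian (\<lambda>x::'a. (\<Sum>b\<in>Basis. (x \<bullet> b)^4) * real DIM('a))"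
    by (intro integrable_mult_left Bochner_Integration.integrable_sum std_gaussian_coord_moment4)
  have "(norm x)^4 \<le> (\<Sum>b\<in>Basis. (x \<bullet> b)^4) * real DIM('a)" for x :: 'a
  proof -
    have "(norm x)^4 = (\<Sum>b\<in>Basis. (x \<bullet> b)\<^sup>2)\<^sup>2"
      by (simp add: norm_sq_Basis[symmetric] flip: power_mult)
    also have "\<dots> \<le> (\<Sum>b\<in>Basis. ((x \<bullet> b)\<^sup>2)\<^sup>2) * real DIM('a)"
      by (rule sum_squared_le_sum_of_squares)
    finally show ?thesis by (simp flip: power_mult)
  qed
  then show "AE x in (std_gaussian::'a measure). norm ((norm x)^4) \<le> norm ((\<Sum>b\<in>Basis. (x \<bullet> b)^4) * real DIM('a))"
    by (intro AE_I2) (simp, metis abs_ge_self order_trans)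
qed simp

lemma integrable_std_gaussian_poly:
  fixes f :: "'a::euclidean_space \<Rightarrow> real"
  assumes [measurable]: "f \<in> borel_measurable borel" and "\<And>x. \<bar>f x\<bar> \<le> C * (1 + (norm x)^4)"
  shows "integrable std_gaussian f"
proof (rule Bochner_Integration.integrable_bound)
  show "integrable std_gaussian (\<lambda>x::'a. C * (1 + (norm x)^4))"
    by (intro integrable_mult_right Bochner_Integration.integrable_add std_gaussian_norm4) simp
  show "AE x in (std_gaussian::'a measure). norm (f x) \<le> norm (C * (1 + (norm x)^4))"
    using assms(2) by (intro AE_I2) (smt (verit) real_norm_def)
qed simp

lemma power_le_1_plus_power4:
  fixes r :: real assumes "r \<ge> 0" "k \<le> 4" shows "r ^ k \<le> 1 + r ^ 4"
proof (cases "r \<le> 1")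
  case True then show ?thesis using assms power_le_one[of r k] by (smt (verit) zero_le_power)
next
  case False then show ?thesis using assms power_increasing[of k 4 r] by linarith
qed

lemma std_gaussian_norm_power: "k \<le> 4 \<Longrightarrow> integrable std_gaussian (\<lambda>x::'a::euclidean_space. (norm x)^k)"
  using power_le_1_plus_power4 by (intro integrable_std_gaussian_poly[of _ 1]) auto

lemma std_gaussian_norm_integrable: "integrable std_gaussian (\<lambda>x::'a::euclidean_space. norm x)"
  using std_gaussian_norm_power[of 1] by simp

section \<open>Orthogonal invariance\<close>

text \<open>A translation-invariant measure agrees with Lebesgue measure up to a constant; evaluating on the
  unit ball shows that the constant is 1.\<close>

lemma distr_lborel_orthogonal:
  fixes f :: "'a::euclidean_space \<Rightarrow> 'a"
  assumes f: "orthogonal_transformation f"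
  shows "distr lborel borel f = lborel"
proof -
  define \<mu> where "\<mu> = distr lborel borel f"
  have lin: "linear f" and bij: "bij f" using f
    by (auto simp: orthogonal_transformation_linear orthogonal_transformation_bij)
  have g: "orthogonal_transformation (inv f)" using f by (rule orthogonal_transformation_inv)
  have m1: "orthogonal_transformation h \<Longrightarrow> h \<in> borel_measurable borel" for h :: "'a \<Rightarrow> 'a"
    by (intro borel_measurable_continuous_onI linear_continuous_on)
       (simp add: linear_conv_bounded_linear[symmetric] orthogonal_transformation_linear)
  note [measurable] = m1[OF f] m1[OF g]
  have sets[simp, measurable_cong]: "sets \<mu> = sets borel" and [simp]: "space \<mu> = UNIV" by (auto simp: \<mu>_def)
  have inv: "inv f (f x) = x" "f (inv f x) = x" for x
    using bij by (auto simp: bij_def surj_f_inv_f)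
  \<comment> \<open>Pushing \<open>\<mu>\<close> forward by \<open>inv f\<close> gives back Lebesgue
    measure, so \<open>\<mu>\<close> inherits sigma-finiteness, which Tonelli below
    requires.\<close>
  have "lborel = distr \<mu> lborel (inv f)"
    unfolding \<mu>_def by (subst distr_distr) (auto simp: comp_def inv distr_id2)
  have sf: "sigma_finite_measure \<mu>"
  proof (rule sigma_finite_measure_distr)
    show "sigma_finite_measure (distr \<mu> lborel (inv f))"
      unfolding \<open>lborel = distr \<mu> lborel (inv f)\<close>[symmetric] by (rule sigma_finite_lborel)
  qed simp
  \<comment> \<open>A translation by \<open>y\<close> after \<open>f\<close> is a translation by
    \<open>inv f y\<close> before \<open>f\<close>, and Lebesgue measure absorbs the latter.\<close>
  have trans: "(\<integral>\<^sup>+x. h (x + y) \<partial>\<mu>) = (\<integral>\<^sup>+x. h x \<partial>\<mu>)"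
    if [measurable]: "h \<in> borel_measurable borel" for h :: "'a \<Rightarrow> ennreal" and y
  proof -
    have "(\<integral>\<^sup>+x. h (x + y) \<partial>\<mu>) = (\<integral>\<^sup>+x. h (f x + y) \<partial>lborel)"
      unfolding \<mu>_def by (subst nn_integral_distr) auto
    also have "\<dots> = (\<integral>\<^sup>+x. h (f (inv f y + x)) \<partial>lborel)"
      using inv by (simp add: linear_add[OF lin] add.commute)
    also have "\<dots> = (\<integral>\<^sup>+x. h (f x) \<partial>distr lborel borel ((+) (inv f y)))"
      by (subst nn_integral_distr) auto
    also have "\<dots> = (\<integral>\<^sup>+x. h (f x) \<partial>lborel)" by (subst lborel_distr_plus) simp
    also have "\<dots> = (\<integral>\<^sup>+x. h x \<partial>\<mu>)"
      unfolding \<mu>_def by (subst nn_integral_distr) auto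
    finally show ?thesis .
  qed
  interpret P: pair_sigma_finite \<mu> "lborel :: 'a measure"
    using sf by (simp add: pair_sigma_finite_def sigma_finite_lborel)
  have ltrans: "(\<integral>\<^sup>+x. h (x + y) \<partial>lborel) = (\<integral>\<^sup>+x. h x \<partial>lborel)"
    if [measurable]: "h \<in> borel_measurable borel" for h :: "'a \<Rightarrow> ennreal" and y
  proof -
    have "(\<integral>\<^sup>+x. h x \<partial>lborel) = (\<integral>\<^sup>+x. h x \<partial>distr lborel borel ((+) y))"
      by (subst lborel_distr_plus) simp
    then show ?thesis by (subst (asm) nn_integral_distr) (auto simp: add.commute)
  qed
  define B where "B = ball (0::'a) 1"
  have [measurable]: "B \<in> sets borel" by (simp add: B_def)
  \<comment> \<open>An isometry fixing the origin preserves the centred ball; this pins the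
    proportionality constant to 1.\<close>
  have "f -` B = B"
    by (auto simp: B_def orthogonal_transformation_norm[OF f])
  then have B\<mu>: "emeasure \<mu> B = emeasure lborel B"
    unfolding \<mu>_def by (subst emeasure_distr) auto
  have Bsym: "indicator B (- x) = (indicator B x :: ennreal)" for x
    by (simp add: B_def indicator_def)
  have Bfin: "emeasure lborel B \<noteq> \<top>" "emeasure lborel B \<noteq> 0"
  proof -
    show "emeasure lborel B \<noteq> \<top>"
      using emeasure_bounded_finite[of B] by (auto simp: B_def)
    have "measure lborel B > 0" unfolding B_def
      using content_ball_pos[of 1 "0::'a"] by simp
    then show "emeasure lborel B \<noteq> 0" by (auto simp: measure_def)
  qed
  have eq: "emeasure \<mu> A = emeasure lborel A" if [measurable]: "A \<in> sets borel" for A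
  proof -
    \<comment> \<open>Double integration: translate \<open>x\<close> by \<open>y\<close> under
      \<open>\<mu>\<close>, swap the integrals, translate \<open>y\<close> back under Lebesgue
      measure, swap again. What is left is an integral of \<open>indicator B (y - x)\<close> over
      \<open>x\<close>, which by symmetry of the ball and invariance of \<open>\<mu>\<close> is the
      \<open>\<mu>\<close>-measure of \<open>B\<close>. The common factor is finite and nonzero, so
      it cancels.\<close>
    have "emeasure \<mu> A * emeasure lborel B
        = (\<integral>\<^sup>+y. (\<integral>\<^sup>+x. indicator A x \<partial>\<mu>) * indicator B y \<partial>lborel)"
      by (simp add: nn_integral_cmult)
    also have "\<dots> = (\<integral>\<^sup>+y. (\<integral>\<^sup>+x. indicator A (x + y) \<partial>\<mu>) * indicator B y \<partial>lborel)"
      by (subst trans) auto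
    also have "\<dots> = (\<integral>\<^sup>+y. (\<integral>\<^sup>+x. indicator A (x + y) * indicator B y \<partial>\<mu>) \<partial>lborel)"
      by (subst nn_integral_multc) auto
    also have "\<dots> = (\<integral>\<^sup>+x. (\<integral>\<^sup>+y. indicator A (x + y) * indicator B y \<partial>lborel) \<partial>\<mu>)"
      by (rule P.Fubini'[of "\<lambda>x y. indicator A (x + y) * indicator B y"]) measurable
    also have "\<dots> = (\<integral>\<^sup>+x. (\<integral>\<^sup>+y. indicator A (y + x) * indicator B (y + x - x) \<partial>lborel) \<partial>\<mu>)"
      by (simp add: add.commute)
    also have "\<dots> = (\<integral>\<^sup>+x. (\<integral>\<^sup>+y. indicator A y * indicator B (y - x) \<partial>lborel) \<partial>\<mu>)"
      by (subst ltrans[of "\<lambda>y. indicator A y * indicator B (y - x)" for x]) auto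
    also have "\<dots> = (\<integral>\<^sup>+y. (\<integral>\<^sup>+x. indicator A y * indicator B (y - x) \<partial>\<mu>) \<partial>lborel)"
      by (rule P.Fubini'[of "\<lambda>x y. indicator A y * indicator B (y - x)", symmetric]) measurable
    also have "\<dots> = (\<integral>\<^sup>+y. indicator A y * (\<integral>\<^sup>+x. indicator B (x + - y) \<partial>\<mu>) \<partial>lborel)"
    proof (rule nn_integral_cong)
      fix y
      have "(indicator B (y - x) :: ennreal) = indicator B (x + - y)" for x
        using Bsym[of "y - x"] by simp
      then show "(\<integral>\<^sup>+x. indicator A y * indicator B (y - x) \<partial>\<mu>)
         = indicator A y * (\<integral>\<^sup>+x. indicator B (x + - y) \<partial>\<mu>)"
        by (subst nn_integral_cmult[symmetric]) auto
    qed
    also have "\<dots> = (\<integral>\<^sup>+y. indicator A y * (\<integral>\<^sup>+x. indicator B x \<partial>\<mu>) \<partial>lborel)"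
      by (subst trans) auto
    also have "\<dots> = emeasure lborel A * emeasure lborel B"
      by (simp add: nn_integral_multc B\<mu>)
    finally show ?thesis
      using Bfin by (auto simp: mult.commute[of _ "emeasure lborel B"] ennreal_mult_cancel_left)
  qed
  have "\<mu> = lborel"
    by (rule measure_eqI) (auto simp: eq)
  then show ?thesis by (simp add: \<mu>_def)
qed

text \<open>The exponents add up to the squared norm; the density being radial is the source of the
  orthogonal invariance.\<close>

lemma std_gaussian_density:
  "(\<Prod>b\<in>Basis. ennreal (std_normal_density (x \<bullet> b)))
     = ennreal ((1 / sqrt (2 * pi)) ^ DIM('a) * exp (- (norm x)\<^sup>2 / 2))" for x :: "'a::euclidean_space"
proof -
  have "(\<Prod>b\<in>Basis. ennreal (std_normal_density (x \<bullet> b))) = ennreal (\<Prod>b\<in>Basis. std_normal_density (x \<bullet> b))"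
    by (rule prod_ennreal) simp
  also have "(\<Prod>b\<in>Basis. std_normal_density (x \<bullet> b))
     = (1 / sqrt (2 * pi)) ^ DIM('a) * exp (\<Sum>b\<in>Basis. - (x \<bullet> b)\<^sup>2 / 2)"
    unfolding std_normal_density_def prod.distrib by (simp add: exp_sum)
  also have "(\<Sum>b\<in>Basis. - (x \<bullet> b)\<^sup>2 / 2) = - (norm x)\<^sup>2 / 2"
    by (simp add: norm_sq_Basis sum_negf sum_divide_distrib)
  finally show ?thesis .
qed

lemma std_gaussian_alt:
  "std_gaussian = density lborel
     (\<lambda>x::'a::euclidean_space. ennreal ((1 / sqrt (2 * pi)) ^ DIM('a) * exp (- (norm x)\<^sup>2 / 2)))"
  by (simp add: std_gaussian_def std_gaussian_density)

lemma distr_std_gaussian_orthogonal: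
  fixes f :: "'a::euclidean_space \<Rightarrow> 'a"
  assumes f: "orthogonal_transformation f"
  shows "distr std_gaussian borel f = std_gaussian"
proof (rule measure_eqI)
  have [measurable]: "f \<in> borel_measurable borel"
    by (intro borel_measurable_continuous_onI linear_continuous_on)
       (simp add: linear_conv_bounded_linear[symmetric] orthogonal_transformation_linear f)
  fix A assume "A \<in> sets (distr std_gaussian borel f)"
  then have [measurable]: "A \<in> sets borel" by simp
  let ?d = "\<lambda>x::'a. ennreal ((1 / sqrt (2 * pi)) ^ DIM('a) * exp (- (norm x)\<^sup>2 / 2))"
  have "emeasure (distr std_gaussian borel f) A = (\<integral>\<^sup>+x. ?d x * indicator A (f x) \<partial>lborel)"
    unfolding std_gaussian_alt
    by (subst nn_integral_indicator[symmetric], simp, subst nn_integral_distr, simp, simp, subst nn_integral_density) auto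
  also have "\<dots> = (\<integral>\<^sup>+x. ?d (f x) * indicator A (f x) \<partial>lborel)"
    by (simp add: orthogonal_transformation_norm[OF f])
  also have "\<dots> = (\<integral>\<^sup>+x. ?d x * indicator A x \<partial>distr lborel borel f)"
    by (subst nn_integral_distr) auto
  also have "\<dots> = emeasure std_gaussian A"
    unfolding distr_lborel_orthogonal[OF f] std_gaussian_alt by (subst emeasure_density) auto
  finally show "emeasure (distr std_gaussian borel f) A = emeasure std_gaussian A" .
qed simp

lemma integral_std_gaussian_orthogonal:
  fixes f :: "'a::euclidean_space \<Rightarrow> 'a" and h :: "'a \<Rightarrow> real"
  assumes f: "orthogonal_transformation f" and [measurable]: "h \<in> borel_measurable borel"
  shows "(\<integral>x. h (f x) \<partial>std_gaussian) = (\<integral>x. h x \<partial>std_gaussian)"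
proof -
  have [measurable]: "f \<in> borel_measurable borel"
    by (intro borel_measurable_continuous_onI linear_continuous_on)
       (simp add: linear_conv_bounded_linear[symmetric] orthogonal_transformation_linear f)
  have "(\<integral>x. h x \<partial>std_gaussian) = (\<integral>x. h x \<partial>distr std_gaussian borel f)"
    by (simp add: distr_std_gaussian_orthogonal[OF f])
  also have "\<dots> = (\<integral>x. h (f x) \<partial>std_gaussian)" by (rule integral_distr) auto
  finally show ?thesis ..
qed

section \<open>Products, rotations and the Gaussian semigroup\<close>

text \<open>The squared norm of a pair is the sum of the squared norms, so the radial densities
  multiply. Two independent Gaussian vectors can thus be handled as one vector in the product
  space.\<close>

lemma pair_std_gaussian:
  "std_gaussian \<Otimes>\<^sub>M std_gaussian = (std_gaussian :: ('a::euclidean_space \<times> 'b::euclidean_space) measure)"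
proof -
  let ?d = "\<lambda>x::'a. ennreal ((1 / sqrt (2 * pi)) ^ DIM('a) * exp (- (norm x)\<^sup>2 / 2))"
  let ?e = "\<lambda>x::'b. ennreal ((1 / sqrt (2 * pi)) ^ DIM('b) * exp (- (norm x)\<^sup>2 / 2))"
  have "std_gaussian \<Otimes>\<^sub>M std_gaussian = density lborel ?d \<Otimes>\<^sub>M density lborel ?e"
    by (simp add: std_gaussian_alt)
  also have "\<dots> = density (lborel \<Otimes>\<^sub>M lborel) (\<lambda>(x, y). ?d x * ?e y)"
  proof (rule pair_measure_density)
    show "sigma_finite_measure (density lborel ?e)"
      using prob_space_imp_sigma_finite[OF prob_space_std_gaussian[where 'a='b]]
      by (simp add: std_gaussian_alt)
  qed (auto intro: sigma_finite_lborel)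
  also have "\<dots> = std_gaussian"
    unfolding lborel_prod std_gaussian_alt
    by (intro arg_cong[where f="density lborel"] ext)
       (auto simp: norm_Pair power_add exp_add[symmetric] field_simps simp flip: ennreal_mult)
  finally show ?thesis .
qed

text \<open>The combination is the first component of the rotation \<open>R\<close> of the product
  space. \<open>R\<close> preserves the product law, and its first marginal is again standard
  Gaussian.\<close>

lemma std_gaussian_rotate:
  assumes cs: "c\<^sup>2 + s\<^sup>2 = 1"
  shows "distr (std_gaussian \<Otimes>\<^sub>M std_gaussian) borel (\<lambda>z. c *\<^sub>R fst z + s *\<^sub>R snd z)
    = (std_gaussian :: 'a::euclidean_space measure)"
proof -
  define R where "R = (\<lambda>z::'a \<times> 'a. (c *\<^sub>R fst z + s *\<^sub>R snd z, c *\<^sub>R snd z - s *\<^sub>R fst z))"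
  have "linear R" unfolding R_def
    by (intro linearI) (auto simp: algebra_simps)
  moreover have "R v \<bullet> R w = v \<bullet> w" for v w
  proof -
    have "R v \<bullet> R w = (c\<^sup>2 + s\<^sup>2) * (fst v \<bullet> fst w) + (c\<^sup>2 + s\<^sup>2) * (snd v \<bullet> snd w)"
      by (simp add: R_def inner_simps algebra_simps power2_eq_square)
    then show ?thesis by (simp add: cs inner_prod_def)
  qed
  ultimately have R: "orthogonal_transformation R"
    by (simp add: orthogonal_transformation_def)
  have [measurable]: "R \<in> borel_measurable borel"
    by (intro borel_measurable_continuous_onI linear_continuous_on)
       (simp add: linear_conv_bounded_linear[symmetric] \<open>linear R\<close>)
  have m: "fst \<in> borel_measurable (borel :: ('a \<times> 'a) measure)"
    by (intro borel_measurable_continuous_onI continuous_intros)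
  have e: "(\<lambda>z. c *\<^sub>R fst z + s *\<^sub>R snd z) = fst \<circ> R" by (auto simp: R_def)
  have "distr (std_gaussian \<Otimes>\<^sub>M std_gaussian) borel (\<lambda>z. c *\<^sub>R fst z + s *\<^sub>R snd z)
      = distr (distr (std_gaussian :: ('a \<times> 'a) measure) borel R) borel fst"
    unfolding e pair_std_gaussian by (rule distr_distr[symmetric]) (use m in auto)
  also have "\<dots> = distr (std_gaussian \<Otimes>\<^sub>M (std_gaussian :: 'a measure)) (std_gaussian :: 'a measure) fst"
    unfolding distr_std_gaussian_orthogonal[OF R] pair_std_gaussian
    by (rule distr_cong) auto
  also have "\<dots> = std_gaussian" by (rule std_gaussian.distr_pair_fst)
  finally show ?thesis .
qed

lemma integrable_std_gaussian_linear_growth: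
  fixes f :: "'a::euclidean_space \<Rightarrow> real"
  assumes "f \<in> borel_measurable borel" and le: "\<And>x. \<bar>f x\<bar> \<le> C + K * norm x" and "K \<ge> 0"
  shows "integrable std_gaussian f"
proof (rule Bochner_Integration.integrable_bound)
  show "integrable std_gaussian (\<lambda>x::'a. C + K * norm x)"
    by (intro integrable_mult_right Bochner_Integration.integrable_add std_gaussian_norm_integrable) simp
  show "AE x in (std_gaussian::'a measure). norm (f x) \<le> norm (C + K * norm x)"
    using le by (intro AE_I2) (smt (verit) real_norm_def)
qed (use assms in auto)

lemma std_gaussian_Fubini:
  fixes h :: "'a::euclidean_space \<times> 'b::euclidean_space \<Rightarrow> real"
  assumes m: "h \<in> borel_measurable borel" and le: "\<And>z. \<bar>h z\<bar> \<le> C + K * norm z" and "K \<ge> 0"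
  shows "(\<integral>x. (\<integral>y. h (x, y) \<partial>std_gaussian) \<partial>std_gaussian) = (\<integral>z. h z \<partial>std_gaussian)" (is ?th1)
    and "(\<integral>y. (\<integral>x. h (x, y) \<partial>std_gaussian) \<partial>std_gaussian) = (\<integral>z. h z \<partial>std_gaussian)" (is ?th2)
    and "integrable std_gaussian (\<lambda>x. \<integral>y. h (x, y) \<partial>std_gaussian)" (is ?th3)
    and "integrable std_gaussian (\<lambda>y. \<integral>x. h (x, y) \<partial>std_gaussian)" (is ?th4)
proof -
  interpret P: pair_sigma_finite "std_gaussian :: 'a measure" "std_gaussian :: 'b measure"
    by (simp add: pair_sigma_finite_def prob_space_imp_sigma_finite prob_space_std_gaussian)
  have "integrable std_gaussian h" using assms by (rule integrable_std_gaussian_linear_growth)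
  then have i: "integrable (std_gaussian \<Otimes>\<^sub>M std_gaussian) (\<lambda>(x, y). h (x, y))"
    by (simp add: pair_std_gaussian)
  show ?th1 using P.integral_fst[OF i] by (simp add: pair_std_gaussian)
  show ?th2 using P.integral_snd[OF i] by (simp add: pair_std_gaussian)
  show ?th3 using P.integrable_fst[OF i] by simp
  show ?th4 using P.integrable_snd[OF i] by simp
qed

text \<open>Variances of independent Gaussian vectors add. After dividing by
  \<open>sqrt (s + t)\<close> the two coefficients lie on the unit circle and the rotation lemma
  applies; total variance 0 is treated apart because of this division.\<close>

lemma std_gaussian_semigroup:
  fixes h :: "'a::euclidean_space \<Rightarrow> real"
  assumes m[measurable]: "h \<in> borel_measurable borel" and le: "\<And>x. \<bar>h x\<bar> \<le> C + K * norm x" and K: "K \<ge> 0"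
    and st: "s \<ge> 0" "t \<ge> 0"
  shows "(\<integral>x. (\<integral>y. h (sqrt s *\<^sub>R x + sqrt t *\<^sub>R y) \<partial>std_gaussian) \<partial>std_gaussian)
    = (\<integral>x. h (sqrt (s + t) *\<^sub>R x) \<partial>std_gaussian)"
proof (cases "s + t = 0")
  case True
  then have "s = 0" "t = 0" using st by auto
  then show ?thesis using std_gaussian.prob_space[where 'a='a] by simp
next
  case False
  define c where "c = sqrt s / sqrt (s + t)"
  define d where "d = sqrt t / sqrt (s + t)"
  have pos: "sqrt (s + t) > 0" using False st by auto
  have cd: "c\<^sup>2 + d\<^sup>2 = 1" using False st
    by (simp add: c_def d_def power_divide add_divide_distrib[symmetric])
  have eq: "sqrt s *\<^sub>R x + sqrt t *\<^sub>R y = sqrt (s + t) *\<^sub>R (c *\<^sub>R x + d *\<^sub>R y)" for x y :: 'a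
    using pos by (simp add: c_def d_def scaleR_add_right)
  have [measurable]: "(\<lambda>z::'a\<times>'a. c *\<^sub>R fst z + d *\<^sub>R snd z) \<in> borel_measurable borel"
    by (intro borel_measurable_continuous_onI continuous_intros)
  have "(\<integral>x. (\<integral>y. h (sqrt s *\<^sub>R x + sqrt t *\<^sub>R y) \<partial>std_gaussian) \<partial>std_gaussian)
     = (\<integral>z. h (sqrt (s + t) *\<^sub>R (c *\<^sub>R fst z + d *\<^sub>R snd z)) \<partial>std_gaussian)"
    unfolding eq
  proof (subst std_gaussian_Fubini(1)[symmetric, where C=C and K="K * (sqrt (s+t) * (\<bar>c\<bar> + \<bar>d\<bar>))"])
    fix z :: "'a \<times> 'a"
    have "norm (c *\<^sub>R fst z + d *\<^sub>R snd z) \<le> \<bar>c\<bar> * norm (fst z) + \<bar>d\<bar> * norm (snd z)"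
      by (metis norm_scaleR norm_triangle_ineq)
    also have "\<dots> \<le> \<bar>c\<bar> * norm z + \<bar>d\<bar> * norm z"
      by (intro add_mono mult_left_mono) (metis norm_fst_le norm_snd_le prod.collapse abs_ge_zero)+
    finally have "norm (sqrt (s + t) *\<^sub>R (c *\<^sub>R fst z + d *\<^sub>R snd z)) \<le> sqrt (s + t) * ((\<bar>c\<bar> + \<bar>d\<bar>) * norm z)"
      using pos by (simp add: distrib_right)
    then have "K * norm (sqrt (s + t) *\<^sub>R (c *\<^sub>R fst z + d *\<^sub>R snd z)) \<le> K * (sqrt (s + t) * ((\<bar>c\<bar> + \<bar>d\<bar>) * norm z))"
      using K by (rule mult_left_mono)
    then show "\<bar>h (sqrt (s + t) *\<^sub>R (c *\<^sub>R fst z + d *\<^sub>R snd z))\<bar> \<le> C + K * (sqrt (s+t) * (\<bar>c\<bar> + \<bar>d\<bar>)) * norm z"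
      using le[of "sqrt (s + t) *\<^sub>R (c *\<^sub>R fst z + d *\<^sub>R snd z)"] by (simp add: mult.assoc)
  qed (use K pos in auto)
  also have "\<dots> = (\<integral>x. h (sqrt (s + t) *\<^sub>R x) \<partial>distr (std_gaussian \<Otimes>\<^sub>M std_gaussian) borel (\<lambda>z. c *\<^sub>R fst z + d *\<^sub>R snd z))"
    unfolding pair_std_gaussian by (subst integral_distr) auto
  also have "\<dots> = (\<integral>x. h (sqrt (s + t) *\<^sub>R x) \<partial>std_gaussian)"
    by (simp add: std_gaussian_rotate[OF cd])
  finally show ?thesis .
qed

section \<open>Mean, covariance and the expected norm\<close>

lemma std_gaussian_mean: "(\<integral>x. u \<bullet> x \<partial>std_gaussian) = 0" for u :: "'a::euclidean_space"
proof -
  have "orthogonal_transformation (\<lambda>x::'a. - x)" by (simp add: orthogonal_transformation_neg)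
  from integral_std_gaussian_orthogonal[OF this, of "\<lambda>x. u \<bullet> x"] show ?thesis by simp
qed

text \<open>The reflection \<open>f\<close> in the hyperplane orthogonal to \<open>b\<close>
  preserves the measure and flips the sign of exactly one factor.\<close>

lemma std_gaussian_cross:
  fixes b c :: "'a::euclidean_space"
  assumes b: "b \<in> Basis" and c: "c \<in> Basis" and "b \<noteq> c"
  shows "(\<integral>x. (x \<bullet> b) * (x \<bullet> c) \<partial>std_gaussian) = 0"
proof -
  have bc: "c \<bullet> b = 0" "b \<bullet> c = 0" "b \<bullet> b = 1" using assms by (auto simp: inner_not_same_Basis)
  define f where "f = (\<lambda>x::'a. x - (2 * (x \<bullet> b)) *\<^sub>R b)"
  have "orthogonal_transformation f"
    unfolding orthogonal_transformation_def f_def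
    by (auto intro!: linearI simp: algebra_simps inner_simps bc inner_commute)
  from integral_std_gaussian_orthogonal[OF this, of "\<lambda>x. (x \<bullet> b) * (x \<bullet> c)"]
  have "(\<integral>x. - ((x \<bullet> b) * (x \<bullet> c)) \<partial>std_gaussian) = (\<integral>x. (x \<bullet> b) * (x \<bullet> c) \<partial>std_gaussian)"
    by (simp add: f_def inner_simps bc)
  then show ?thesis by simp
qed

lemma integrable_std_gaussian_inner_mult:
  "integrable std_gaussian (\<lambda>x. (u \<bullet> x) * (v \<bullet> x))" for u v :: "'a::euclidean_space"
proof (rule Bochner_Integration.integrable_bound)
  show "integrable std_gaussian (\<lambda>x::'a. (norm u * norm v) * (norm x)\<^sup>2)"
    by (intro integrable_mult_right std_gaussian_norm_power) simp
  have "\<bar>(u \<bullet> x) * (v \<bullet> x)\<bar> \<le> (norm u * norm v) * (norm x)\<^sup>2" for x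
    using mult_mono[OF Cauchy_Schwarz_ineq2[of u x] Cauchy_Schwarz_ineq2[of v x]]
    by (simp add: abs_mult power2_eq_square mult_ac)
  then show "AE x in (std_gaussian::'a measure). norm ((u \<bullet> x) * (v \<bullet> x)) \<le> norm ((norm u * norm v) * (norm x)\<^sup>2)"
    by (intro AE_I2) (simp add: abs_mult)
qed simp

lemma std_gaussian_second_moment:
  "(\<integral>x. (u \<bullet> x) * (v \<bullet> x) \<partial>std_gaussian) = u \<bullet> v" for u v :: "'a::euclidean_space"
proof -
  have i: "integrable std_gaussian (\<lambda>x::'a. (x \<bullet> b) * (x \<bullet> c))" for b c
    using integrable_std_gaussian_inner_mult[of b c] by (simp add: inner_commute)
  have e: "(\<integral>x. (x \<bullet> b) * (x \<bullet> c) \<partial>std_gaussian) = (if b = c then 1 else 0)" if "b \<in> Basis" "c \<in> Basis" for b c :: 'a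
    using std_gaussian_cross[OF that] std_gaussian_coord_moment2[OF that(1)]
    by (auto simp: power2_eq_square has_bochner_integral_iff)
  have "(u \<bullet> x) * (v \<bullet> x) = (\<Sum>b\<in>Basis. \<Sum>c\<in>Basis. ((u \<bullet> b) * (v \<bullet> c)) * ((x \<bullet> b) * (x \<bullet> c)))" for x
    by (subst euclidean_inner[of u x], subst euclidean_inner[of v x]) (simp add: sum_product mult_ac)
  then have "(\<integral>x. (u \<bullet> x) * (v \<bullet> x) \<partial>std_gaussian)
     = (\<Sum>b\<in>Basis. \<Sum>c\<in>Basis. ((u \<bullet> b) * (v \<bullet> c)) * (\<integral>x. (x \<bullet> b) * (x \<bullet> c) \<partial>std_gaussian))"
    using i by (simp add: Bochner_Integration.integral_sum Bochner_Integration.integrable_sum)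
  also have "\<dots> = (\<Sum>b\<in>Basis. \<Sum>c\<in>Basis. if b = c then (u \<bullet> b) * (v \<bullet> c) else 0)"
    by (intro sum.cong refl) (simp add: e)
  also have "\<dots> = u \<bullet> v" by (simp add: sum.delta euclidean_inner[of u v])
  finally show ?thesis .
qed

lemma (in prob_space) expectation_le_sqrt_second_moment:
  fixes X :: "'a \<Rightarrow> real"
  assumes "integrable M X" "integrable M (\<lambda>x. (X x)\<^sup>2)"
  shows "expectation X \<le> sqrt (expectation (\<lambda>x. (X x)\<^sup>2))"
proof -
  have "0 \<le> variance X" by (rule variance_positive)
  then have "(expectation X)\<^sup>2 \<le> expectation (\<lambda>x. (X x)\<^sup>2)" using variance_eq[OF assms] by simp
  then show ?thesis by (rule real_le_rsqrt)
qed

text \<open>The expected squared norm of each component is its dimension, and a nonnegative variance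
  bounds the expected norm by the square root of that. This is the right-hand side of Chevet's
  inequality.\<close>

lemma std_gaussian_prod_norm_le:
  shows "(\<integral>z. norm (fst z) + norm (snd z) \<partial>(std_gaussian :: ('a::euclidean_space \<times> 'b::euclidean_space) measure))
    \<le> sqrt (real DIM('a)) + sqrt (real DIM('b))"
    and "integrable (std_gaussian :: ('a \<times> 'b) measure) (\<lambda>z. norm (fst z) + norm (snd z))"
proof -
  have mf[measurable]: "fst \<in> borel_measurable (borel :: ('a \<times> 'b) measure)"
    and ms[measurable]: "snd \<in> borel_measurable (borel :: ('a \<times> 'b) measure)"
    by (intro borel_measurable_continuous_onI continuous_intros)+
  have nf: "norm (fst z) \<le> norm z" and ns: "norm (snd z) \<le> norm z" for z :: "'a \<times> 'b"
    using norm_fst_le[of "fst z" "snd z"] norm_snd_le[of "snd z" "fst z"] by auto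
  have i1: "integrable std_gaussian (\<lambda>z::'a\<times>'b. norm (fst z))"
    and i2: "integrable std_gaussian (\<lambda>z::'a\<times>'b. norm (snd z))"
    using nf ns by (auto intro!: integrable_std_gaussian_linear_growth[where C=0 and K=1])
  have sq: "r \<le> t \<Longrightarrow> 0 \<le> r \<Longrightarrow> \<bar>r\<^sup>2\<bar> \<le> 1 * (1 + t ^ 4)" for r t :: real
    using power_le_1_plus_power4[of t 2] power_mono[of r t 2] by (simp, linarith)
  have j1: "integrable std_gaussian (\<lambda>z::'a\<times>'b. (norm (fst z))\<^sup>2)"
    by (rule integrable_std_gaussian_poly[where C=1]) (use nf sq in auto)
  have j2: "integrable std_gaussian (\<lambda>z::'a\<times>'b. (norm (snd z))\<^sup>2)"
    by (rule integrable_std_gaussian_poly[where C=1]) (use ns sq in auto)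
  have e: "(\<integral>z. (z \<bullet> b)\<^sup>2 \<partial>(std_gaussian :: ('a \<times> 'b) measure)) = 1"
    and ie: "integrable std_gaussian (\<lambda>z::'a\<times>'b. (z \<bullet> b)\<^sup>2)" if "b \<in> Basis" for b
    using std_gaussian_coord_moment2[OF that] by (auto simp: has_bochner_integral_iff)
  have b1: "(b, 0) \<in> (Basis :: ('a \<times> 'b) set)" if "b \<in> Basis" for b
    using that by (auto simp: Basis_prod_def)
  have b2: "(0, b) \<in> (Basis :: ('a \<times> 'b) set)" if "b \<in> Basis" for b
    using that by (auto simp: Basis_prod_def)
  have "(norm (fst z))\<^sup>2 = (\<Sum>b\<in>Basis. (z \<bullet> (b, 0))\<^sup>2)" for z :: "'a \<times> 'b"
    by (simp add: norm_sq_Basis inner_prod_def)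
  then have "(\<integral>z. (norm (fst z))\<^sup>2 \<partial>(std_gaussian :: ('a \<times> 'b) measure)) = real DIM('a)"
    by (simp add: Bochner_Integration.integral_sum ie b1 e)
  then have l1: "(\<integral>z. norm (fst z) \<partial>(std_gaussian :: ('a \<times> 'b) measure)) \<le> sqrt (real DIM('a))"
    using std_gaussian.expectation_le_sqrt_second_moment[OF i1 j1] by simp
  have "(norm (snd z))\<^sup>2 = (\<Sum>b\<in>Basis. (z \<bullet> (0, b))\<^sup>2)" for z :: "'a \<times> 'b"
    by (simp add: norm_sq_Basis inner_prod_def)
  then have "(\<integral>z. (norm (snd z))\<^sup>2 \<partial>(std_gaussian :: ('a \<times> 'b) measure)) = real DIM('b)"
    by (simp add: Bochner_Integration.integral_sum ie b2 e)
  then have l2: "(\<integral>z. norm (snd z) \<partial>(std_gaussian :: ('a \<times> 'b) measure)) \<le> sqrt (real DIM('b))"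
    using std_gaussian.expectation_le_sqrt_second_moment[OF i2 j2] by simp
  show "(\<integral>z. norm (fst z) + norm (snd z) \<partial>(std_gaussian :: ('a \<times> 'b) measure))
    \<le> sqrt (real DIM('a)) + sqrt (real DIM('b))"
    using l1 l2 by (simp add: i1 i2)
  show "integrable (std_gaussian :: ('a \<times> 'b) measure) (\<lambda>z. norm (fst z) + norm (snd z))"
    using i1 i2 by simp
qed

text \<open>Open boxes form an intersection-stable generator of the Borel sets, and on a box both
  measures factor over the coordinates: one by independence, the other by the product
  formula.\<close>

lemma (in prob_space) distr_eq_std_gaussianI:
  fixes X :: "'a \<Rightarrow> 'b::euclidean_space"
  assumes ind: "indep_vars (\<lambda>_. borel) (\<lambda>b \<omega>. X \<omega> \<bullet> b) Basis"
    and dist: "\<And>b. b \<in> Basis \<Longrightarrow> distributed M lborel (\<lambda>\<omega>. X \<omega> \<bullet> b) std_normal_density"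
  shows "distr M borel X = std_gaussian"
proof (rule measure_eqI_generator_eq)
  let ?E = "range (\<lambda>(a, b). box a b::'b set)"
  have [measurable]: "(\<lambda>\<omega>. X \<omega> \<bullet> b) \<in> borel_measurable M" if "b \<in> Basis" for b
    using ind that by (auto simp: indep_vars_def)
  have [measurable]: "X \<in> borel_measurable M"
    by (subst borel_measurable_euclidean_space) auto
  interpret D: prob_space "distr M borel X" by (rule prob_space_distr) simp
  show "Int_stable ?E"
    by (auto simp: Int_stable_def box_Int_box)
  show "?E \<subseteq> Pow UNIV" "sets (distr M borel X) = sigma_sets UNIV ?E" "sets std_gaussian = sigma_sets UNIV ?E"
    by (simp_all add: borel_eq_box)
  let ?A = "\<lambda>n::nat. box (- (real n *\<^sub>R One)) (real n *\<^sub>R One) :: 'b set"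
  show "range ?A \<subseteq> ?E" "(\<Union>i. ?A i) = UNIV"
    unfolding UN_box_eq_UNIV by auto
  show "emeasure (distr M borel X) (?A i) \<noteq> \<infinity>" for i
    by (simp add: D.emeasure_eq_measure)
  show "emeasure (distr M borel X) S = emeasure std_gaussian S" if S_box: "S \<in> ?E" for S
  proof -
    obtain l u where S: "S = box l u" using S_box by auto
    define J where "J = (\<lambda>b::'b. {l \<bullet> b <..< u \<bullet> b})"
    have N: "emeasure M ((\<lambda>\<omega>. X \<omega> \<bullet> b) -` J b \<inter> space M) = emeasure std_normal_distribution (J b)"
      if "b \<in> Basis" for b
    proof -
      have "std_normal_distribution = distr M lborel (\<lambda>\<omega>. X \<omega> \<bullet> b)"
        using dist[OF that] by (simp add: distributed_def)
      then show ?thesis using that by (simp add: J_def emeasure_distr)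
    qed
    have "emeasure (distr M borel X) S = emeasure M (\<Inter>b\<in>Basis. (\<lambda>\<omega>. X \<omega> \<bullet> b) -` J b \<inter> space M)"
      unfolding S by (subst emeasure_distr) (auto simp: J_def box_def intro!: arg_cong[where f="emeasure M"])
    also have "\<dots> = (\<Prod>b\<in>Basis. emeasure M ((\<lambda>\<omega>. X \<omega> \<bullet> b) -` J b \<inter> space M))"
      unfolding emeasure_eq_measure
      by (subst indep_varsD_finite[OF ind]) (auto simp: J_def prod_ennreal)
    also have "\<dots> = (\<Prod>b\<in>Basis. \<integral>\<^sup>+t. indicator (J b) t \<partial>std_normal_distribution)"
      by (intro prod.cong refl, subst N) (auto simp: J_def)
    also have "\<dots> = (\<integral>\<^sup>+x. (\<Prod>b\<in>Basis. indicator (J b) (x \<bullet> b)) \<partial>std_gaussian)"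
      by (rule nn_integral_std_gaussian_prod[symmetric]) (auto simp: J_def)
    also have "\<dots> = (\<integral>\<^sup>+x. indicator S x \<partial>std_gaussian)"
      by (intro nn_integral_cong) (auto simp: S J_def box_def indicator_def)
    also have "\<dots> = emeasure std_gaussian S" by (simp add: S)
    finally show ?thesis .
  qed
qed

section \<open>Comparison of Gaussian processes\<close>

text \<open>There is no inverse temperature parameter; it enters later by scaling
  \<open>c\<close>.\<close>

definition log_sum_exp :: "'t set \<Rightarrow> ('t \<Rightarrow> real) \<Rightarrow> real" where
  "log_sum_exp T c = ln (\<Sum>t\<in>T. exp (c t))"

lemma sum_exp_pos: "finite T \<Longrightarrow> T \<noteq> {} \<Longrightarrow> (\<Sum>t\<in>T. exp (c t :: real)) > 0"
  by (rule sum_pos) auto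

lemma log_sum_exp_ge:
  assumes "finite T" "t \<in> T" shows "c t \<le> log_sum_exp T c"
proof -
  have "exp (c t) \<le> (\<Sum>t\<in>T. exp (c t))" using assms by (intro member_le_sum) auto
  then show ?thesis using assms unfolding log_sum_exp_def
    by (subst ln_ge_iff) (auto intro: sum_exp_pos)
qed

text \<open>Adding \<open>B\<close> to all arguments multiplies the sum by \<open>exp B\<close>.
  Taking \<open>d\<close> zero gives the upper bound by the maximum; using it in both directions
  gives the Lipschitz estimate in the sup norm.\<close>

lemma log_sum_exp_mono_add:
  assumes "finite T" "T \<noteq> {}" and "\<And>t. t \<in> T \<Longrightarrow> c t \<le> d t + B"
  shows "log_sum_exp T c \<le> log_sum_exp T d + B"
proof -
  have "(\<Sum>t\<in>T. exp (c t)) \<le> (\<Sum>t\<in>T. exp (d t) * exp B)"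
    using assms by (intro sum_mono) (auto simp flip: exp_add)
  then have "(\<Sum>t\<in>T. exp (c t)) \<le> (\<Sum>t\<in>T. exp (d t)) * exp B" by (simp add: sum_distrib_right)
  then have "log_sum_exp T c \<le> ln ((\<Sum>t\<in>T. exp (d t)) * exp B)"
    unfolding log_sum_exp_def using sum_exp_pos[OF assms(1,2)] by (subst ln_le_cancel_iff) auto
  then show ?thesis using sum_exp_pos[OF assms(1,2), of d] by (simp add: log_sum_exp_def ln_mult_pos)
qed

lemma log_sum_exp_le:
  assumes "finite T" "T \<noteq> {}" and "\<And>t. t \<in> T \<Longrightarrow> c t \<le> B"
  shows "log_sum_exp T c \<le> B + ln (real (card T))"
  using log_sum_exp_mono_add[of T c "\<lambda>_. 0" B] assms by (simp add: log_sum_exp_def)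

lemma log_sum_exp_lipschitz:
  assumes "finite T" "T \<noteq> {}" and "\<And>t. t \<in> T \<Longrightarrow> \<bar>c t - d t\<bar> \<le> B"
  shows "\<bar>log_sum_exp T c - log_sum_exp T d\<bar> \<le> B"
proof -
  have "c t \<le> d t + B" "d t \<le> c t + B" if "t \<in> T" for t using assms(3)[OF that] by auto
  then show ?thesis using log_sum_exp_mono_add[OF assms(1,2), of c d B] log_sum_exp_mono_add[OF assms(1,2), of d c B]
    by auto
qed

text \<open>These are the partial derivatives of \<open>log_sum_exp T\<close>; as probability
  weights on \<open>T\<close> they turn its Taylor coefficients into moments.\<close>

definition gibbs_weight :: "'t set \<Rightarrow> ('t \<Rightarrow> real) \<Rightarrow> 't \<Rightarrow> real" where
  "gibbs_weight T c t = exp (c t) / (\<Sum>t\<in>T. exp (c t))"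

lemma gibbs_weight_nonneg: "finite T \<Longrightarrow> 0 \<le> gibbs_weight T c t"
  by (simp add: gibbs_weight_def sum_nonneg)

lemma gibbs_weight_sum: "finite T \<Longrightarrow> T \<noteq> {} \<Longrightarrow> (\<Sum>t\<in>T. gibbs_weight T c t) = 1"
  using sum_exp_pos[of T c] by (simp add: gibbs_weight_def sum_divide_distrib[symmetric])

text \<open>Taylor's formula in one variable along \<open>c t + s * b t\<close> for \<open>s\<close>
  from 0 to 1. The derivatives in \<open>s\<close> are the cumulants of \<open>b\<close> under the
  Gibbs weights: the first is the mean, the second the variance, and the third is controlled by
  \<open>B\<close>.\<close>

lemma log_sum_exp_taylor:
  fixes T :: "'t set" and b c :: "'t \<Rightarrow> real"
  assumes T: "finite T" "T \<noteq> {}" and B: "\<And>t. t \<in> T \<Longrightarrow> \<bar>b t\<bar> \<le> B"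
  defines "p \<equiv> gibbs_weight T c"
  shows "\<bar>log_sum_exp T (\<lambda>t. c t + b t) - log_sum_exp T c - (\<Sum>t\<in>T. p t * b t)
           - ((\<Sum>t\<in>T. p t * (b t)\<^sup>2) - (\<Sum>t\<in>T. p t * b t)\<^sup>2) / 2\<bar> \<le> B ^ 3"
proof -
  define S where "S = (\<lambda>k s. \<Sum>t\<in>T. b t ^ k * exp (c t + s * b t))"
  have S0: "S 0 s > 0" for s unfolding S_def using T by (auto intro!: sum_pos)
  have dS: "(S k has_real_derivative S (Suc k) s) (at s)" for k s
    unfolding S_def by (auto intro!: derivative_eq_intros sum.cong simp: mult_ac)
  \<comment> \<open>The \<open>k\<close>-th moment of \<open>b\<close> under the Gibbs weights at
    the shifted argument.\<close>
  define q where "q = (\<lambda>k s. S k s / S 0 s)"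
  have q: "\<bar>q k s\<bar> \<le> B ^ k" for k s
  proof -
    have "\<bar>S k s\<bar> \<le> (\<Sum>t\<in>T. B ^ k * exp (c t + s * b t))"
      unfolding S_def using B by (intro sum_abs[THEN order_trans] sum_mono)
         (auto simp: abs_mult power_abs intro!: mult_right_mono power_mono)
    also have "\<dots> = B ^ k * S 0 s" by (simp add: S_def sum_distrib_left)
    finally show ?thesis using S0[of s] by (simp add: q_def abs_divide divide_le_eq)
  qed
  have dq: "(q k has_real_derivative (q (Suc k) s - q k s * q 1 s)) (at s)" for k s
    unfolding q_def using S0[of s]
    by (auto intro!: derivative_eq_intros dS simp: field_simps power2_eq_square)
  \<comment> \<open>The function along the segment, followed by its mean, variance and third
    cumulant, the last as it comes out of differentiating the variance.\<close>
  define diff where "diff = (\<lambda>m::nat. if m = 0 then (\<lambda>s. ln (S 0 s)) else if m = 1 then q 1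
     else if m = 2 then (\<lambda>s. q 2 s - (q 1 s)\<^sup>2)
     else (\<lambda>s. q 3 s - q 2 s * q 1 s - 2 * q 1 s * (q 2 s - (q 1 s)\<^sup>2)))"
  have D0: "((\<lambda>s. ln (S 0 s)) has_real_derivative q 1 s) (at s)" for s
    using S0[of s] by (auto intro!: derivative_eq_intros dS simp: q_def)
  have D1: "(q 1 has_real_derivative q 2 s - (q 1 s)\<^sup>2) (at s)" for s
    using dq[of 1 s] by (simp add: power2_eq_square numeral_2_eq_2)
  have D2: "((\<lambda>s. q 2 s - (q 1 s)\<^sup>2) has_real_derivative
     (q 3 s - q 2 s * q 1 s - 2 * q 1 s * (q 2 s - (q 1 s)\<^sup>2))) (at s)" for s
    using DERIV_diff[OF dq[of 2 s] DERIV_power[OF D1[of s], of 2]]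
    by (simp add: numeral_3_eq_3 numeral_2_eq_2 mult_ac)
  have "\<exists>s. 0 < s \<and> s \<le> 1 \<and> (\<lambda>s. ln (S 0 s)) 1 = (\<Sum>m<3. diff m 0 / fact m * 1 ^ m) + diff 3 s / fact 3 * 1 ^ 3"
  proof (rule Maclaurin2)
    show "\<forall>m s. m < 3 \<and> 0 \<le> s \<and> s \<le> 1 \<longrightarrow> (diff m has_real_derivative diff (Suc m) s) (at s)"
    proof (intro allI impI)
      fix m :: nat and s :: real assume "m < 3 \<and> 0 \<le> s \<and> s \<le> 1"
      then have "m = 0 \<or> m = 1 \<or> m = 2" by auto
      then show "(diff m has_real_derivative diff (Suc m) s) (at s)"
        using D0[of s] D1[of s] D2[of s] by (auto simp: diff_def)
    qed
  qed (auto simp: diff_def)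
  then obtain s where s: "ln (S 0 1) = ln (S 0 0) + q 1 0 + (q 2 0 - (q 1 0)\<^sup>2) / 2 + diff 3 s / 6"
    by (auto simp: diff_def numeral_3_eq_3 fact_numeral)
  \<comment> \<open>The third cumulant has coefficients 1, 3 and 2 in absolute value, each
    multiplying a quantity of size at most \<open>B ^ 3\<close>; their sum 6 cancels the factorial
    in the remainder.\<close>
  have "\<bar>diff 3 s\<bar> \<le> 6 * B ^ 3"
  proof -
    have B0: "B \<ge> 0" using T B by force
    have e: "diff 3 s = q 3 s - 3 * (q 1 s * q 2 s) + 2 * q 1 s ^ 3"
      by (simp add: diff_def algebra_simps power2_eq_square power3_eq_cube)
    have "\<bar>q 1 s * q 2 s\<bar> \<le> B ^ 1 * B ^ 2" unfolding abs_mult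
      by (intro mult_mono q) (use B0 in auto)
    moreover have "\<bar>q 1 s ^ 3\<bar> \<le> B ^ 3" unfolding power_abs using q[of 1 s] by (intro power_mono) auto
    ultimately show ?thesis unfolding e using q[of 3 s] by (simp add: power3_eq_cube power2_eq_square)
  qed
  moreover have "log_sum_exp T (\<lambda>t. c t + b t) = ln (S 0 1)" "log_sum_exp T c = ln (S 0 0)"
    by (simp_all add: log_sum_exp_def S_def)
  moreover have "(\<Sum>t\<in>T. p t * b t) = q 1 0" "(\<Sum>t\<in>T. p t * (b t)\<^sup>2) = q 2 0"
    by (simp_all add: q_def S_def p_def gibbs_weight_def sum_divide_distrib mult.commute)
  ultimately show ?thesis using s by simp
qed

lemma log_sum_exp_linear_measurable [measurable]:
  fixes a :: "'t \<Rightarrow> 'a::euclidean_space"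
  shows "(\<lambda>x. log_sum_exp T (\<lambda>t. c t + a t \<bullet> x)) \<in> borel_measurable borel"
  unfolding log_sum_exp_def by measurable

lemma log_sum_exp_linear_growth:
  fixes a :: "'t \<Rightarrow> 'a::euclidean_space"
  assumes T: "finite T" "T \<noteq> {}" and K: "\<And>t. t \<in> T \<Longrightarrow> norm (a t) \<le> K"
  shows "\<bar>log_sum_exp T (\<lambda>t. c t + a t \<bullet> x)\<bar> \<le> \<bar>log_sum_exp T c\<bar> + K * norm x"
proof -
  have "\<bar>a t \<bullet> x\<bar> \<le> K * norm x" if "t \<in> T" for t
    using Cauchy_Schwarz_ineq2[of "a t" x] mult_right_mono[OF K[OF that], of "norm x"] by simp
  then have "\<bar>log_sum_exp T (\<lambda>t. c t + a t \<bullet> x) - log_sum_exp T c\<bar> \<le> K * norm x"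
    by (intro log_sum_exp_lipschitz T) auto
  then show ?thesis by linarith
qed

lemma log_sum_exp_linear_integrable:
  fixes a :: "'t \<Rightarrow> 'a::euclidean_space"
  assumes T: "finite T" "T \<noteq> {}"
  shows "integrable std_gaussian (\<lambda>x. log_sum_exp T (\<lambda>t. c t + a t \<bullet> x))"
proof (rule integrable_std_gaussian_linear_growth)
  define K where "K = (\<Sum>t\<in>T. norm (a t))"
  have "norm (a t) \<le> K" if "t \<in> T" for t unfolding K_def using that T by (intro member_le_sum) auto
  then show "\<bar>log_sum_exp T (\<lambda>t. c t + a t \<bullet> x)\<bar> \<le> \<bar>log_sum_exp T c\<bar> + K * norm x" for x
    by (rule log_sum_exp_linear_growth[OF T])
  show "K \<ge> 0" by (simp add: K_def sum_nonneg)
qed simp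

section \<open>The effect of a small Gaussian perturbation\<close>

text \<open>A variance is half the mean squared distance of two independent copies. In this form the
  second-order Taylor term involves only the increments \<open>a s - a t\<close>, which are what the
  comparison hypothesis controls.\<close>

lemma weighted_variance_pairs:
  fixes a :: "'t \<Rightarrow> 'a::real_inner"
  assumes "(\<Sum>t\<in>T. p t) = 1"
  shows "(\<Sum>t\<in>T. p t * (norm (a t))\<^sup>2) - (norm (\<Sum>t\<in>T. p t *\<^sub>R a t))\<^sup>2
    = (\<Sum>s\<in>T. \<Sum>t\<in>T. p s * p t * (norm (a s - a t))\<^sup>2) / 2"
proof -
  have "(\<Sum>s\<in>T. \<Sum>t\<in>T. p s * p t * (norm (a s - a t))\<^sup>2)
     = (\<Sum>s\<in>T. \<Sum>t\<in>T. p s * (norm (a s))\<^sup>2 * p t) + (\<Sum>s\<in>T. \<Sum>t\<in>T. p s * (p t * (norm (a t))\<^sup>2))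
       - 2 * (\<Sum>s\<in>T. \<Sum>t\<in>T. p s * p t * (a s \<bullet> a t))"
    unfolding sum.distrib[symmetric] sum_distrib_left sum_subtractf[symmetric]
    by (intro sum.cong refl) (simp add: power2_norm_eq_inner inner_simps inner_commute algebra_simps)
  also have "(\<Sum>s\<in>T. \<Sum>t\<in>T. p s * (norm (a s))\<^sup>2 * p t) = (\<Sum>t\<in>T. p t * (norm (a t))\<^sup>2)"
    by (simp add: sum_distrib_left[symmetric] assms)
  also have "(\<Sum>s\<in>T. \<Sum>t\<in>T. p s * (p t * (norm (a t))\<^sup>2)) = (\<Sum>t\<in>T. p t * (norm (a t))\<^sup>2)"
    by (simp add: sum_distrib_left[symmetric] sum_distrib_right[symmetric] assms)
  also have "(\<Sum>s\<in>T. \<Sum>t\<in>T. p s * p t * (a s \<bullet> a t)) = (norm (\<Sum>t\<in>T. p t *\<^sub>R a t))\<^sup>2"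
    by (simp add: power2_norm_eq_inner inner_sum_left inner_sum_right sum_distrib_left mult_ac inner_commute)
  finally show ?thesis by simp
qed

text \<open>Integrate the Taylor expansion: the linear term vanishes because the mean is 0, and the
  quadratic term becomes a variance of the vectors \<open>a t\<close>. The factor 1/4 is the Taylor
  coefficient 1/2 times the 1/2 from the pair form of the variance.\<close>

lemma log_sum_exp_gaussian_step:
  fixes a :: "'t \<Rightarrow> 'a::euclidean_space" and c :: "'t \<Rightarrow> real"
  assumes T: "finite T" "T \<noteq> {}" and K: "\<And>t. t \<in> T \<Longrightarrow> norm (a t) \<le> K" and r: "r \<ge> 0"
  defines "p \<equiv> gibbs_weight T c"
  shows "\<bar>(\<integral>x. log_sum_exp T (\<lambda>t. c t + a t \<bullet> (r *\<^sub>R x)) \<partial>std_gaussian) - log_sum_exp T c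
           - r\<^sup>2 / 4 * (\<Sum>s\<in>T. \<Sum>t\<in>T. p s * p t * (norm (a s - a t))\<^sup>2)\<bar>
         \<le> r ^ 3 * (K ^ 3 * (\<integral>x. norm x ^ 3 \<partial>(std_gaussian :: 'a measure)))"
proof -
  define m where "m = (\<Sum>t\<in>T. p t *\<^sub>R a t)"
  define L where "L = (\<lambda>x. log_sum_exp T (\<lambda>t. c t + a t \<bullet> (r *\<^sub>R x)))"
  \<comment> \<open>The linear and quadratic Taylor terms at the perturbation
    \<open>a t \<bullet> (r *\<^sub>R x)\<close>, with \<open>m\<close> the Gibbs mean of the
    vectors.\<close>
  define M where "M = (\<lambda>x. r * (m \<bullet> x) + r\<^sup>2 * ((\<Sum>t\<in>T. p t * (a t \<bullet> x)\<^sup>2) - (m \<bullet> x)\<^sup>2) / 2)"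
  have iL: "integrable std_gaussian L"
    unfolding L_def using log_sum_exp_linear_integrable[OF T, of c "\<lambda>t. r *\<^sub>R a t"] by simp
  have i2: "integrable std_gaussian (\<lambda>x. (u \<bullet> x)\<^sup>2)" for u :: 'a
    unfolding power2_eq_square by (rule integrable_std_gaussian_inner_mult)
  have i1: "integrable std_gaussian (\<lambda>x. u \<bullet> x)" for u :: 'a
    by (rule integrable_std_gaussian_linear_growth[where C=0 and K="norm u"]) (auto simp: Cauchy_Schwarz_ineq2)
  have e2: "(\<integral>x. (u \<bullet> x)\<^sup>2 \<partial>std_gaussian) = (norm u)\<^sup>2" for u :: 'a
    unfolding power2_eq_square by (simp add: std_gaussian_second_moment power2_norm_eq_inner[symmetric] power2_eq_square)
  have iM: "integrable std_gaussian M"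
    unfolding M_def by (auto intro!: Bochner_Integration.integrable_add Bochner_Integration.integrable_diff
        Bochner_Integration.integrable_sum integrable_mult_right i1 i2)
  have "(\<integral>x. M x \<partial>std_gaussian) = r\<^sup>2 * ((\<Sum>t\<in>T. p t * (norm (a t))\<^sup>2) - (norm m)\<^sup>2) / 2"
    unfolding M_def by (simp add: i1 i2 e2 std_gaussian_mean Bochner_Integration.integrable_sum Bochner_Integration.integral_sum)
  also have "\<dots> = r\<^sup>2 / 4 * (\<Sum>s\<in>T. \<Sum>t\<in>T. p s * p t * (norm (a s - a t))\<^sup>2)"
    unfolding m_def by (subst weighted_variance_pairs) (simp_all add: p_def gibbs_weight_sum T)
  finally have eM: "(\<integral>x. M x \<partial>std_gaussian) = \<dots>" .
  have pw: "\<bar>L x - log_sum_exp T c - M x\<bar> \<le> r ^ 3 * (K ^ 3 * norm x ^ 3)" for x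
  proof -
    have b: "\<bar>r * (a t \<bullet> x)\<bar> \<le> r * (K * norm x)" if "t \<in> T" for t
      unfolding abs_mult using r Cauchy_Schwarz_ineq2[of "a t" x] mult_right_mono[OF K[OF that], of "norm x"]
      by (intro mult_mono) auto
    have e1: "(\<Sum>t\<in>T. p t * (r * (a t \<bullet> x))) = r * (m \<bullet> x)"
      by (simp add: m_def inner_sum_left sum_distrib_left mult_ac)
    have e2: "(\<Sum>t\<in>T. p t * (r * (a t \<bullet> x))\<^sup>2) = r\<^sup>2 * (\<Sum>t\<in>T. p t * (a t \<bullet> x)\<^sup>2)"
      by (simp add: sum_distrib_left power_mult_distrib mult_ac)
    have "M x = (\<Sum>t\<in>T. p t * (r * (a t \<bullet> x))) + ((\<Sum>t\<in>T. p t * (r * (a t \<bullet> x))\<^sup>2) - (\<Sum>t\<in>T. p t * (r * (a t \<bullet> x)))\<^sup>2) / 2"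
      unfolding e1 e2 M_def by (simp add: algebra_simps power_mult_distrib)
    then show ?thesis
      using log_sum_exp_taylor[OF T, where b="\<lambda>t. r * (a t \<bullet> x)" and B="r * (K * norm x)" and c=c, OF b] by (simp add: L_def p_def power_mult_distrib diff_diff_eq)
  qed
  have "(\<integral>x. L x \<partial>std_gaussian) - log_sum_exp T c - (\<integral>x. M x \<partial>std_gaussian)
      = (\<integral>x. L x - log_sum_exp T c - M x \<partial>std_gaussian)"
    using iL iM std_gaussian.prob_space[where 'a='a] by simp
  also have "\<bar>\<dots>\<bar> \<le> (\<integral>x. \<bar>L x - log_sum_exp T c - M x\<bar> \<partial>std_gaussian)"
    by (rule integral_abs_bound)
  also have "\<dots> \<le> (\<integral>x. r ^ 3 * (K ^ 3 * norm x ^ 3) \<partial>(std_gaussian :: 'a measure))"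
    using iL iM pw std_gaussian_norm_power[of 3, where 'a='a] by (intro integral_mono) auto
  also have "\<dots> = r ^ 3 * (K ^ 3 * (\<integral>x. norm x ^ 3 \<partial>(std_gaussian :: 'a measure)))"
    by simp
  finally show ?thesis unfolding eM by (simp add: L_def)
qed

section \<open>Lindeberg replacement and Sudakov-Fernique\<close>

text \<open>The two linear perturbations are a single one by \<open>(a t, b t)\<close> on the
  product space, where linear growth gives integrability.\<close>

lemma log_sum_exp_Fubini:
  fixes a :: "'t \<Rightarrow> 'a::euclidean_space" and b :: "'t \<Rightarrow> 'b::euclidean_space"
  assumes T: "finite T" "T \<noteq> {}"
  shows "(\<integral>x. (\<integral>y. log_sum_exp T (\<lambda>t. c t + a t \<bullet> x + b t \<bullet> y) \<partial>std_gaussian) \<partial>std_gaussian)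
       = (\<integral>y. (\<integral>x. log_sum_exp T (\<lambda>t. c t + a t \<bullet> x + b t \<bullet> y) \<partial>std_gaussian) \<partial>std_gaussian)" (is ?th1)
    and "integrable std_gaussian (\<lambda>x. \<integral>y. log_sum_exp T (\<lambda>t. c t + a t \<bullet> x + b t \<bullet> y) \<partial>std_gaussian)" (is ?th2)
    and "integrable std_gaussian (\<lambda>y. \<integral>x. log_sum_exp T (\<lambda>t. c t + a t \<bullet> x + b t \<bullet> y) \<partial>std_gaussian)" (is ?th3)
proof -
  define h where "h = (\<lambda>z. log_sum_exp T (\<lambda>t. c t + (a t, b t) \<bullet> z))"
  define K where "K = (\<Sum>t\<in>T. norm (a t, b t))"
  have "norm (a t, b t) \<le> K" if "t \<in> T" for t unfolding K_def using that T by (intro member_le_sum) auto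
  then have 1: "\<bar>h z\<bar> \<le> \<bar>log_sum_exp T c\<bar> + K * norm z" for z
    unfolding h_def using T by (intro log_sum_exp_linear_growth)
  have 2: "K \<ge> 0" by (simp add: K_def sum_nonneg)
  have 3: "h \<in> borel_measurable borel" unfolding h_def by (rule log_sum_exp_linear_measurable)
  have e: "log_sum_exp T (\<lambda>t. c t + a t \<bullet> x + b t \<bullet> y) = h (x, y)" for x y
    by (simp add: h_def add.assoc)
  note F = std_gaussian_Fubini[OF 3 1 2]
  show ?th1 unfolding e using F(1,2) by simp
  show ?th2 unfolding e by (rule F(3))
  show ?th3 unfolding e by (rule F(4))
qed

lemma log_sum_exp_semigroup:
  fixes a :: "'t \<Rightarrow> 'a::euclidean_space"
  assumes T: "finite T" "T \<noteq> {}" and st: "r \<ge> 0" "s \<ge> 0"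
  shows "(\<integral>x. (\<integral>y. log_sum_exp T (\<lambda>t. c t + a t \<bullet> (sqrt r *\<^sub>R x) + a t \<bullet> (sqrt s *\<^sub>R y)) \<partial>std_gaussian) \<partial>std_gaussian)
     = (\<integral>x. log_sum_exp T (\<lambda>t. c t + a t \<bullet> (sqrt (r + s) *\<^sub>R x)) \<partial>std_gaussian)"
proof -
  define K where "K = (\<Sum>t\<in>T. norm (a t))"
  have "norm (a t) \<le> K" if "t \<in> T" for t unfolding K_def using that T by (intro member_le_sum) auto
  note le = log_sum_exp_linear_growth[OF T, where a=a and c=c, OF this]
  have "K \<ge> 0" by (simp add: K_def sum_nonneg)
  from std_gaussian_semigroup[OF log_sum_exp_linear_measurable le this st]
  show ?thesis by (simp add: inner_add_right add.assoc)
qed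

text \<open>The second-order terms compare with the right sign since the Gibbs weights are
  nonnegative and depend on \<open>c\<close> alone, so they are the same on both sides. The constant
  does not depend on \<open>c\<close>: in the replacement argument the pieces not being exchanged
  act as a random shift \<open>c\<close>.\<close>

lemma log_sum_exp_gaussian_compare_step:
  fixes a :: "'t \<Rightarrow> 'a::euclidean_space" and b :: "'t \<Rightarrow> 'b::euclidean_space"
  assumes T: "finite T" "T \<noteq> {}"
    and le: "\<And>s t. s \<in> T \<Longrightarrow> t \<in> T \<Longrightarrow> norm (a s - a t) \<le> norm (b s - b t)"
  shows "\<exists>C. \<forall>c. \<forall>r\<ge>0. (\<integral>x. log_sum_exp T (\<lambda>t. c t + a t \<bullet> (r *\<^sub>R x)) \<partial>std_gaussian)
     \<le> (\<integral>y. log_sum_exp T (\<lambda>t. c t + b t \<bullet> (r *\<^sub>R y)) \<partial>std_gaussian) + C * r ^ 3"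
proof -
  define K where "K = (\<Sum>t\<in>T. norm (a t))"
  define L where "L = (\<Sum>t\<in>T. norm (b t))"
  have K: "norm (a t) \<le> K" if "t \<in> T" for t unfolding K_def using that T by (intro member_le_sum) auto
  have L: "norm (b t) \<le> L" if "t \<in> T" for t unfolding L_def using that T by (intro member_le_sum) auto
  define C1 where "C1 = K ^ 3 * (\<integral>x. norm x ^ 3 \<partial>(std_gaussian :: 'a measure))"
  define C2 where "C2 = L ^ 3 * (\<integral>x. norm x ^ 3 \<partial>(std_gaussian :: 'b measure))"
  have "(\<integral>x. log_sum_exp T (\<lambda>t. c t + a t \<bullet> (r *\<^sub>R x)) \<partial>std_gaussian)
     \<le> (\<integral>y. log_sum_exp T (\<lambda>t. c t + b t \<bullet> (r *\<^sub>R y)) \<partial>std_gaussian) + (C1 + C2) * r ^ 3"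
    if r: "r \<ge> 0" for c r
  proof -
    define p where "p = gibbs_weight T c"
    have "(\<Sum>s\<in>T. \<Sum>t\<in>T. p s * p t * (norm (a s - a t))\<^sup>2) \<le> (\<Sum>s\<in>T. \<Sum>t\<in>T. p s * p t * (norm (b s - b t))\<^sup>2)"
      using le T by (intro sum_mono mult_left_mono power_mono) (auto simp: p_def gibbs_weight_nonneg)
    then have "r\<^sup>2 / 4 * (\<Sum>s\<in>T. \<Sum>t\<in>T. p s * p t * (norm (a s - a t))\<^sup>2)
       \<le> r\<^sup>2 / 4 * (\<Sum>s\<in>T. \<Sum>t\<in>T. p s * p t * (norm (b s - b t))\<^sup>2)"
      by (rule mult_left_mono) simp
    with log_sum_exp_gaussian_step[OF T, where a=a and c=c, OF K r]
      log_sum_exp_gaussian_step[OF T, where a=b and c=c, OF L r]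
    show ?thesis unfolding C1_def[symmetric] C2_def[symmetric] p_def[symmetric]
      by (simp add: algebra_simps)
  qed
  then show ?thesis by blast
qed

lemma log_sum_exp_gaussian_compare:
  fixes a :: "'t \<Rightarrow> 'a::euclidean_space" and b :: "'t \<Rightarrow> 'b::euclidean_space"
  assumes T: "finite T" "T \<noteq> {}"
    and le: "\<And>s t. s \<in> T \<Longrightarrow> t \<in> T \<Longrightarrow> norm (a s - a t) \<le> norm (b s - b t)"
  shows "(\<integral>x. log_sum_exp T (\<lambda>t. a t \<bullet> x) \<partial>std_gaussian) \<le> (\<integral>y. log_sum_exp T (\<lambda>t. b t \<bullet> y) \<partial>std_gaussian)"
proof -
  \<comment> \<open>\<open>\<Phi> s\<close> and \<open>\<Psi> s\<close> average over a Gaussian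
    perturbation of variance \<open>s\<close> along \<open>a\<close> and along \<open>b\<close>, as
    functions of the shift.\<close>
  define \<Phi> where "\<Phi> = (\<lambda>s c. \<integral>x. log_sum_exp T (\<lambda>t. c t + a t \<bullet> (sqrt s *\<^sub>R x)) \<partial>std_gaussian)"
  define \<Psi> where "\<Psi> = (\<lambda>s c. \<integral>y. log_sum_exp T (\<lambda>t. c t + b t \<bullet> (sqrt s *\<^sub>R y)) \<partial>std_gaussian)"
  obtain C where "\<forall>c. \<forall>r\<ge>0. (\<integral>x. log_sum_exp T (\<lambda>t. c t + a t \<bullet> (r *\<^sub>R x)) \<partial>std_gaussian)
     \<le> (\<integral>y. log_sum_exp T (\<lambda>t. c t + b t \<bullet> (r *\<^sub>R y)) \<partial>std_gaussian) + C * r ^ 3"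
    using log_sum_exp_gaussian_compare_step[OF T, where a=a and b=b, OF le] by blast
  then have step: "\<Phi> \<tau> c \<le> \<Psi> \<tau> c + C * sqrt \<tau> ^ 3" if "\<tau> \<ge> 0" for c \<tau>
    using that by (simp add: \<Phi>_def \<Psi>_def)
  \<comment> \<open>Induction on the number of pieces of variance \<open>\<tau>\<close>. One
    \<open>a\<close>-piece is split off by the semigroup property and the other \<open>m\<close> are
    exchanged by the induction hypothesis, whose shift contains the split-off piece. After Fubini
    that piece is integrated first, exchanged by \<open>step\<close>, and merged with the
    \<open>m\<close> pieces along \<open>b\<close>.\<close>
  have iter: "\<Phi> (real m * \<tau>) c \<le> \<Psi> (real m * \<tau>) c + real m * (C * sqrt \<tau> ^ 3)" if \<tau>: "\<tau> \<ge> 0" for m \<tau> c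
  proof (induction m arbitrary: c)
    case 0
    show ?case by (simp add: \<Phi>_def \<Psi>_def std_gaussian.prob_space[where 'a='a, simplified] std_gaussian.prob_space[where 'a='b, simplified])
  next
    case (Suc m)
    have F: "(\<integral>x. \<Psi> (real m * \<tau>) (\<lambda>t. c t + a t \<bullet> (sqrt \<tau> *\<^sub>R x)) \<partial>std_gaussian)
        = (\<integral>y. \<Phi> \<tau> (\<lambda>t. c t + b t \<bullet> (sqrt (real m * \<tau>) *\<^sub>R y)) \<partial>std_gaussian)"
      using log_sum_exp_Fubini(1)[OF T, of c "\<lambda>t. sqrt \<tau> *\<^sub>R a t" "\<lambda>t. sqrt (real m * \<tau>) *\<^sub>R b t"]
      by (simp add: \<Phi>_def \<Psi>_def algebra_simps)
    have i1: "integrable std_gaussian (\<lambda>x. \<Psi> (real m * \<tau>) (\<lambda>t. c t + a t \<bullet> (sqrt \<tau> *\<^sub>R x)))"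
      using log_sum_exp_Fubini(2)[OF T, of c "\<lambda>t. sqrt \<tau> *\<^sub>R a t" "\<lambda>t. sqrt (real m * \<tau>) *\<^sub>R b t"]
      by (simp add: \<Psi>_def)
    have i2: "integrable std_gaussian (\<lambda>y. \<Phi> \<tau> (\<lambda>t. c t + b t \<bullet> (sqrt (real m * \<tau>) *\<^sub>R y)))"
      using log_sum_exp_Fubini(3)[OF T, of c "\<lambda>t. sqrt \<tau> *\<^sub>R a t" "\<lambda>t. sqrt (real m * \<tau>) *\<^sub>R b t"]
      by (simp add: \<Phi>_def algebra_simps)
    have i3: "integrable std_gaussian (\<lambda>x. \<Phi> (real m * \<tau>) (\<lambda>t. c t + a t \<bullet> (sqrt \<tau> *\<^sub>R x)))"
      using log_sum_exp_Fubini(2)[OF T, of c "\<lambda>t. sqrt \<tau> *\<^sub>R a t" "\<lambda>t. sqrt (real m * \<tau>) *\<^sub>R a t"]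
      by (simp add: \<Phi>_def)
    have i4: "integrable std_gaussian (\<lambda>y. \<Psi> \<tau> (\<lambda>t. c t + b t \<bullet> (sqrt (real m * \<tau>) *\<^sub>R y)))"
      using log_sum_exp_Fubini(2)[OF T, of c "\<lambda>t. sqrt (real m * \<tau>) *\<^sub>R b t" "\<lambda>t. sqrt \<tau> *\<^sub>R b t"]
      by (simp add: \<Psi>_def)
    have "\<Phi> (real (Suc m) * \<tau>) c = (\<integral>x. \<Phi> (real m * \<tau>) (\<lambda>t. c t + a t \<bullet> (sqrt \<tau> *\<^sub>R x)) \<partial>std_gaussian)"
      using log_sum_exp_semigroup[OF T, of \<tau> "real m * \<tau>" c a] \<tau> by (simp add: \<Phi>_def algebra_simps)
    also have "\<dots> \<le> (\<integral>x. \<Psi> (real m * \<tau>) (\<lambda>t. c t + a t \<bullet> (sqrt \<tau> *\<^sub>R x)) + real m * (C * sqrt \<tau> ^ 3) \<partial>std_gaussian)"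
      using i1 i3 by (intro integral_mono Suc.IH) auto
    also have "\<dots> = (\<integral>y. \<Phi> \<tau> (\<lambda>t. c t + b t \<bullet> (sqrt (real m * \<tau>) *\<^sub>R y)) \<partial>std_gaussian) + real m * (C * sqrt \<tau> ^ 3)"
      unfolding F[symmetric] using i1 std_gaussian.prob_space[where 'a='a] by simp
    also have "(\<integral>y. \<Phi> \<tau> (\<lambda>t. c t + b t \<bullet> (sqrt (real m * \<tau>) *\<^sub>R y)) \<partial>std_gaussian)
       \<le> (\<integral>y. \<Psi> \<tau> (\<lambda>t. c t + b t \<bullet> (sqrt (real m * \<tau>) *\<^sub>R y)) + C * sqrt \<tau> ^ 3 \<partial>std_gaussian)"
      using i2 i4 by (intro integral_mono step \<tau>) auto
    also have "\<dots> = (\<integral>y. \<Psi> \<tau> (\<lambda>t. c t + b t \<bullet> (sqrt (real m * \<tau>) *\<^sub>R y)) \<partial>std_gaussian) + C * sqrt \<tau> ^ 3"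
      using i4 std_gaussian.prob_space[where 'a='b] by simp
    also have "(\<integral>y. \<Psi> \<tau> (\<lambda>t. c t + b t \<bullet> (sqrt (real m * \<tau>) *\<^sub>R y)) \<partial>std_gaussian) = \<Psi> (real (Suc m) * \<tau>) c"
      using log_sum_exp_semigroup[OF T, of "real m * \<tau>" \<tau> c b] \<tau> by (simp add: \<Psi>_def algebra_simps)
    finally show ?case by (simp add: algebra_simps)
  qed
  \<comment> \<open>With \<open>m\<close> pieces of variance \<open>1 / m\<close> the errors sum to
    \<open>m\<close> times \<open>m powr (-3/2)\<close>, which tends to 0.\<close>
  have "\<Phi> 1 (\<lambda>_. 0) \<le> \<Psi> 1 (\<lambda>_. 0) + C * (1 / sqrt (real m))" if m: "m > 0" for m :: nat
  proof -
    have "real m * (C * sqrt (1 / real m) ^ 3) = C * (1 / sqrt (real m))"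
      using m by (simp add: real_sqrt_divide power3_eq_cube field_simps)
    then show ?thesis using iter[of "1 / real m" m "\<lambda>_. 0"] m by simp
  qed
  then have ev: "eventually (\<lambda>m. \<Phi> 1 (\<lambda>_. 0) \<le> \<Psi> 1 (\<lambda>_. 0) + C * (1 / sqrt (real m))) sequentially"
    by (intro eventually_sequentiallyI[of 1]) auto
  have "(\<lambda>m. 1 / sqrt (real m)) \<longlonglongrightarrow> 0"
    by (intro tendsto_divide_0[OF tendsto_const] filterlim_at_top_imp_at_infinity
        filterlim_compose[OF sqrt_at_top filterlim_real_sequentially])
  then have "(\<lambda>m. \<Psi> 1 (\<lambda>_. 0) + C * (1 / sqrt (real m))) \<longlonglongrightarrow> \<Psi> 1 (\<lambda>_. 0) + C * 0"
    by (intro tendsto_intros)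
  with ev have "\<Phi> 1 (\<lambda>_. 0) \<le> \<Psi> 1 (\<lambda>_. 0) + C * 0"
    by (intro tendsto_lowerbound[of _ _ sequentially]) auto
  then show ?thesis by (simp add: \<Phi>_def \<Psi>_def)
qed

text \<open>\<open>g\<close> and \<open>f\<close> stand below and above the two maxima. This lets a
  discretized supremum enter on the left and a closed-form bound on the right without integrating
  the maxima themselves.\<close>

theorem sudakov_fernique:
  fixes a :: "'t \<Rightarrow> 'a::euclidean_space" and b :: "'t \<Rightarrow> 'b::euclidean_space"
  assumes T: "finite T" "T \<noteq> {}"
    and le: "\<And>s t. s \<in> T \<Longrightarrow> t \<in> T \<Longrightarrow> norm (a s - a t) \<le> norm (b s - b t)"
    and g: "integrable std_gaussian g" "\<And>x. \<exists>t\<in>T. g x \<le> a t \<bullet> x"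
    and f: "integrable std_gaussian f" "\<And>y t. t \<in> T \<Longrightarrow> b t \<bullet> y \<le> f y"
  shows "(\<integral>x. g x \<partial>std_gaussian) \<le> (\<integral>y. f y \<partial>std_gaussian)"
proof -
  \<comment> \<open>Scaling the vectors by \<open>\<beta>\<close> and dividing by it afterwards
    makes the gap between maximum and smooth maximum \<open>ln (card T) / \<beta>\<close>.\<close>
  have main: "(\<integral>x. g x \<partial>std_gaussian) \<le> (\<integral>y. f y \<partial>std_gaussian) + ln (real (card T)) * (1 / real \<beta>)" if "\<beta> > 0" for \<beta> :: nat
  proof -
    let ?\<beta> = "real \<beta>"
    have "?\<beta> * (\<integral>x. g x \<partial>std_gaussian) = (\<integral>x. ?\<beta> * g x \<partial>std_gaussian)" by simp
    also have "\<dots> \<le> (\<integral>x. log_sum_exp T (\<lambda>t. (?\<beta> *\<^sub>R a t) \<bullet> x) \<partial>std_gaussian)"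
    proof (rule integral_mono)
      fix x
      obtain t where t: "t \<in> T" "g x \<le> a t \<bullet> x" using g by blast
      then have "?\<beta> * g x \<le> (?\<beta> *\<^sub>R a t) \<bullet> x" by (simp add: mult_left_mono)
      also have "\<dots> \<le> log_sum_exp T (\<lambda>t. (?\<beta> *\<^sub>R a t) \<bullet> x)" using t T by (intro log_sum_exp_ge)
      finally show "?\<beta> * g x \<le> \<dots>" .
    qed (use g log_sum_exp_linear_integrable[OF T, of "\<lambda>_. 0" "\<lambda>t. ?\<beta> *\<^sub>R a t"] in auto)
    also have "\<dots> \<le> (\<integral>y. log_sum_exp T (\<lambda>t. (?\<beta> *\<^sub>R b t) \<bullet> y) \<partial>std_gaussian)"
      using le by (intro log_sum_exp_gaussian_compare T) (simp add: scaleR_diff_right[symmetric] mult_left_mono)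
    also have "\<dots> \<le> (\<integral>y. ?\<beta> * f y + ln (real (card T)) \<partial>std_gaussian)"
      using f log_sum_exp_linear_integrable[OF T, of "\<lambda>_. 0" "\<lambda>t. ?\<beta> *\<^sub>R b t"]
      by (intro integral_mono log_sum_exp_le T) (auto intro: mult_left_mono)
    also have "\<dots> = ?\<beta> * (\<integral>y. f y \<partial>std_gaussian) + ln (real (card T))"
      using f(1) std_gaussian.prob_space[where 'a='b] by simp
    finally show ?thesis using that by (simp add: field_simps)
  qed
  then have ev: "eventually (\<lambda>\<beta>. (\<integral>x. g x \<partial>std_gaussian) \<le> (\<integral>y. f y \<partial>std_gaussian) + ln (real (card T)) * (1 / real \<beta>)) sequentially"
    by (intro eventually_sequentiallyI[of 1]) auto
  have "(\<lambda>\<beta>. (\<integral>y. f y \<partial>std_gaussian) + ln (real (card T)) * (1 / real \<beta>)) \<longlonglongrightarrow> (\<integral>y. f y \<partial>std_gaussian) + ln (real (card T)) * 0"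
    by (intro tendsto_intros lim_1_over_n)
  with ev have "(\<integral>x. g x \<partial>std_gaussian) \<le> (\<integral>y. f y \<partial>std_gaussian) + ln (real (card T)) * 0"
    by (intro tendsto_lowerbound[of _ _ sequentially]) auto
  then show ?thesis by simp
qed

section \<open>Norms and Chevet's bound\<close>

lemma seminorm_nonneg:
  fixes N :: "'a::real_vector \<Rightarrow> real"
  assumes tri: "\<And>x y. N (x + y) \<le> N x + N y" and hom: "\<And>c x. N (c *\<^sub>R x) = \<bar>c\<bar> * N x"
  shows "0 \<le> N x"
  using tri[of x "- x"] hom[of "-1" x] hom[of 0 x] by simp

text \<open>Expansion in the basis bounds \<open>N\<close> by the Euclidean norm, and the reverse
  triangle inequality gives the Lipschitz estimate. The summand 1 in \<open>C\<close> keeps it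
  positive even if \<open>N\<close> vanishes.\<close>

lemma seminorm_bound:
  fixes N :: "'a::euclidean_space \<Rightarrow> real"
  assumes tri: "\<And>x y. N (x + y) \<le> N x + N y" and hom: "\<And>c x. N (c *\<^sub>R x) = \<bar>c\<bar> * N x"
  obtains C where "C > 0" "\<And>x. N x \<le> C * norm x" "\<And>x y. \<bar>N x - N y\<bar> \<le> C * dist x y"
proof -
  note nn = seminorm_nonneg[of N, OF tri hom]
  define C where "C = 1 + (\<Sum>b\<in>Basis. N b)"
  have "C > 0" unfolding C_def by (intro add_pos_nonneg sum_nonneg) (auto simp: nn)
  have s: "N (\<Sum>b\<in>B. f b) \<le> (\<Sum>b\<in>B. N (f b))" if "finite B" for B and f :: "'a \<Rightarrow> 'a"
    using that
  proof induction
    case empty show ?case using hom[of 0 0] by simp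
  next
    case (insert b B) then show ?case using tri[of "f b" "sum f B"] by simp
  qed
  have b: "N x \<le> C * norm x" for x
  proof -
    have "N x = N (\<Sum>b\<in>Basis. (x \<bullet> b) *\<^sub>R b)" by (simp add: euclidean_representation)
    also have "\<dots> \<le> (\<Sum>b\<in>Basis. \<bar>x \<bullet> b\<bar> * N b)" using s[of Basis "\<lambda>b. (x \<bullet> b) *\<^sub>R b"] by (simp add: hom)
    also have "\<dots> \<le> (\<Sum>b\<in>Basis. norm x * N b)"
      by (intro sum_mono mult_right_mono) (auto simp: Basis_le_norm nn)
    also have "\<dots> = norm x * (\<Sum>b\<in>Basis. N b)" by (simp add: sum_distrib_left)
    also have "\<dots> \<le> C * norm x" by (simp add: C_def algebra_simps)
    finally show ?thesis .
  qed
  have "\<bar>N x - N y\<bar> \<le> C * dist x y" for x y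
    using tri[of "x - y" y] tri[of "y - x" x] b[of "x - y"] b[of "y - x"]
    by (simp add: dist_norm norm_minus_commute)
  with \<open>C > 0\<close> b show ?thesis by (rule that)
qed

lemma Lipschitz_continuous_on:
  fixes f :: "'a::metric_space \<Rightarrow> real"
  assumes "C \<ge> 0" "\<And>x y. \<bar>f x - f y\<bar> \<le> C * dist x y"
  shows "continuous_on S f"
proof -
  have "C-lipschitz_on S f"
    using assms by (intro lipschitz_onI) (auto simp: dist_real_def)
  then show ?thesis by (rule lipschitz_on_continuous_on)
qed

section \<open>The spectral norm and its Gaussian expectation\<close>

lemma spectral_norm_apply: "norm (A *v x) \<le> spectral_norm A * norm x"
  unfolding spectral_norm_def by (rule onorm) simp

lemma spectral_norm_add: "spectral_norm (A + B) \<le> spectral_norm A + spectral_norm B"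
  unfolding spectral_norm_def matrix_vector_mult_add_rdistrib
  by (rule onorm_triangle) auto

lemma spectral_norm_scaleR: "spectral_norm (c *\<^sub>R A) = \<bar>c\<bar> * spectral_norm A"
  unfolding spectral_norm_def scaleR_matrix_vector_assoc[symmetric]
  by (rule onorm_scaleR) simp

lemma spectral_norm_nonneg: "0 \<le> spectral_norm A"
  by (intro seminorm_nonneg[of spectral_norm] spectral_norm_add spectral_norm_scaleR)

text \<open>Compactness of the sphere provides a maximizing \<open>u\<close>. For \<open>v\<close>
  take the direction of \<open>A *v u\<close>, or any unit vector when that image is 0.\<close>

lemma spectral_norm_attained:
  fixes A :: "real ^ 'm ^ 'n"
  shows "\<exists>u v. norm u = 1 \<and> norm v = 1 \<and> v \<bullet> (A *v u) = spectral_norm A"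
proof -
  have "\<exists>u\<in>sphere 0 1. \<forall>w\<in>sphere (0::real^'m) 1. norm (A *v w) \<le> norm (A *v u)"
    by (intro continuous_attains_sup continuous_intros compact_sphere) (auto simp: sphere_eq_empty)
  then obtain u where u: "norm u = 1" and max: "\<And>w. norm w = 1 \<Longrightarrow> norm (A *v w) \<le> norm (A *v u)"
    by auto
  have "norm (A *v w) \<le> norm (A *v u) * norm w" for w
  proof (cases "w = 0")
    case False
    have "A *v w = norm w *\<^sub>R (A *v (w /\<^sub>R norm w))"
      using False by (simp add: matrix_vector_mult_scaleR)
    then have "norm (A *v w) = norm w * norm (A *v (w /\<^sub>R norm w))" by (metis abs_norm_cancel norm_scaleR)
    then show ?thesis using max[of "w /\<^sub>R norm w"] False by (simp add: mult.commute mult_left_mono)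
  qed simp
  then have le: "spectral_norm A \<le> norm (A *v u)"
    unfolding spectral_norm_def by (rule onorm_le)
  have eq: "spectral_norm A = norm (A *v u)"
    using le spectral_norm_apply[of A u] u by simp
  show ?thesis
  proof (cases "A *v u = 0")
    case True
    obtain v :: "real^'n" where "norm v = 1" using vector_choose_size[of 1] by auto
    then show ?thesis using u eq True by (intro exI[of _ u] exI[of _ v]) simp
  next
    case False
    then show ?thesis using u eq
      by (intro exI[of _ u] exI[of _ "(A *v u) /\<^sub>R norm (A *v u)"])
         (simp add: power2_norm_eq_inner[symmetric] power2_eq_square)
  qed
qed

definition outer_prod :: "real ^ 'n \<Rightarrow> real ^ 'k \<Rightarrow> real ^ 'k ^ 'n" where
  "outer_prod v u = (\<chi> i j. v $ i * u $ j)"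

text \<open>This presents \<open>v \<bullet> (A *v u)\<close> as a linear functional of the Gaussian
  matrix, the form of process that the comparison theorem takes.\<close>

lemma outer_prod_inner: "outer_prod v u \<bullet> A = v \<bullet> (A *v u)"
  by (simp add: outer_prod_def inner_vec_def matrix_vector_mult_def sum_distrib_left mult_ac)

lemma outer_prod_inner_outer_prod: "outer_prod v u \<bullet> outer_prod v' u' = (v \<bullet> v') * (u \<bullet> u')"
  by (simp add: outer_prod_def inner_vec_def sum_product) (simp add: mult_ac)

text \<open>For unit vectors the two squared increments differ by
  \<open>2 (1 - v \<bullet> v') (1 - u \<bullet> u')\<close>.\<close>

lemma outer_prod_increment_le:
  assumes "norm u = 1" "norm v = 1" "norm u' = 1" "norm v' = 1"
  shows "norm (outer_prod v u - outer_prod v' u') \<le> norm ((v, u) - (v', u'))"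
proof (rule power2_le_imp_le)
  have 1: "u \<bullet> u = 1" "v \<bullet> v = 1" "u' \<bullet> u' = 1" "v' \<bullet> v' = 1"
    using assms by (simp_all add: norm_eq_1)
  have "v \<bullet> v' \<le> 1" "u \<bullet> u' \<le> 1"
    using norm_cauchy_schwarz[of v v'] norm_cauchy_schwarz[of u u'] assms by auto
  then have "0 \<le> (1 - v \<bullet> v') * (1 - u \<bullet> u')" by simp
  then have "0 \<le> 1 - v \<bullet> v' - u \<bullet> u' + (v \<bullet> v') * (u \<bullet> u')" by (simp add: algebra_simps)
  moreover have "(norm (outer_prod v u - outer_prod v' u'))\<^sup>2 = 2 - 2 * ((v \<bullet> v') * (u \<bullet> u'))"
    by (simp add: power2_norm_eq_inner inner_diff_left inner_diff_right outer_prod_inner_outer_prod 1 inner_commute)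
  moreover have "(norm ((v, u) - (v', u')))\<^sup>2 = 4 - 2 * (v \<bullet> v') - 2 * (u \<bullet> u')"
    by (simp add: power2_norm_eq_inner inner_diff_left inner_diff_right 1 inner_commute)
  ultimately show "(norm (outer_prod v u - outer_prod v' u'))\<^sup>2 \<le> (norm ((v, u) - (v', u')))\<^sup>2"
    by linarith
qed simp

lemma finite_sphere_net:
  assumes "e > 0"
  obtains S :: "'a::euclidean_space set" where "finite S" "S \<subseteq> sphere 0 1" "\<And>x. norm x = 1 \<Longrightarrow> \<exists>y\<in>S. norm (x - y) < e"
proof -
  have "\<exists>S. finite S \<and> S \<subseteq> sphere (0::'a) 1 \<and> sphere 0 1 \<subseteq> (\<Union>y\<in>S. ball y e)"
    using seq_compact_imp_totally_bounded[OF compact_imp_seq_compact[OF compact_sphere[of "0::'a" 1]]] assms by auto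
  then obtain S where "finite S" "S \<subseteq> sphere (0::'a) 1" "sphere 0 1 \<subseteq> (\<Union>y\<in>S. ball y e)" by blast
  moreover have "\<exists>y\<in>S. norm (x - y) < e" if "norm x = 1" for x
  proof -
    have "x \<in> sphere 0 1" using that by simp
    then obtain y where "y \<in> S" "x \<in> ball y e" using calculation by blast
    then show ?thesis by (auto simp: dist_norm norm_minus_commute)
  qed
  ultimately show ?thesis using that by blast
qed

lemma spectral_norm_integrable: "integrable std_gaussian (spectral_norm :: real ^ 'k ^ 'n \<Rightarrow> real)"
proof -
  obtain C where C: "C > 0" "\<And>X::real^'k^'n. spectral_norm X \<le> C * norm X"
    "\<And>X Y::real^'k^'n. \<bar>spectral_norm X - spectral_norm Y\<bar> \<le> C * dist X Y"
    using seminorm_bound[of "spectral_norm :: real^'k^'n \<Rightarrow> real", OF spectral_norm_add spectral_norm_scaleR] by blast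
  have m: "(spectral_norm :: real^'k^'n \<Rightarrow> real) \<in> borel_measurable borel"
    using C by (intro borel_measurable_continuous_onI Lipschitz_continuous_on[of C]) auto
  show "integrable std_gaussian (spectral_norm :: real ^ 'k ^ 'n \<Rightarrow> real)"
    by (rule integrable_std_gaussian_linear_growth[OF m, where C=0 and K=C]) (use C in \<open>auto simp: abs_of_nonneg spectral_norm_nonneg\<close>)
qed

text \<open>The comparison theorem concerns finite index sets, so both unit spheres are replaced by
  finite \<open>e\<close>-nets. Each of the two arguments costs at most \<open>e\<close> times the
  spectral norm, whence the factor \<open>1 - 2 * e\<close>; then \<open>e\<close> tends to
  0.\<close>

theorem chevet_spectral_norm:
  "(\<integral>X. spectral_norm X \<partial>(std_gaussian :: (real ^ 'k ^ 'n) measure))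
    \<le> sqrt (real CARD('n)) + sqrt (real CARD('k))"
proof -
  define E where "E = (\<integral>X. spectral_norm X \<partial>(std_gaussian :: (real ^ 'k ^ 'n) measure))"
  define B where "B = sqrt (real CARD('n)) + sqrt (real CARD('k))"
  have main: "(1 - 2 * e) * E \<le> B" if e: "0 < e" for e
  proof -
    obtain V :: "(real^'n) set" where V: "finite V" "V \<subseteq> sphere 0 1" "\<And>x. norm x = 1 \<Longrightarrow> \<exists>y\<in>V. norm (x - y) < e"
      using finite_sphere_net[OF e] by blast
    obtain U :: "(real^'k) set" where U: "finite U" "U \<subseteq> sphere 0 1" "\<And>x. norm x = 1 \<Longrightarrow> \<exists>y\<in>U. norm (x - y) < e"
      using finite_sphere_net[OF e] by blast
    have ex: "\<exists>t\<in>V \<times> U. (1 - 2 * e) * spectral_norm X \<le> outer_prod (fst t) (snd t) \<bullet> X" for X :: "real^'k^'n"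
    proof -
      obtain u v where uv: "norm u = 1" "norm v = 1" "v \<bullet> (X *v u) = spectral_norm X"
        using spectral_norm_attained by blast
      obtain u' v' where uv': "u' \<in> U" "norm (u - u') < e" "v' \<in> V" "norm (v - v') < e"
        using U(3)[OF uv(1)] V(3)[OF uv(2)] by blast
      have n1: "norm v' = 1" using uv' V by auto
      \<comment> \<open>The two arguments are moved to the net one after the other, first
        \<open>v\<close> and then \<open>u\<close>.\<close>
      have "(v - v') \<bullet> (X *v u) \<le> norm (v - v') * norm (X *v u)" by (rule norm_cauchy_schwarz)
      also have "\<dots> \<le> e * (spectral_norm X * norm u)"
        using uv' e by (intro mult_mono spectral_norm_apply) auto
      finally have 1: "(v - v') \<bullet> (X *v u) \<le> e * spectral_norm X" using uv by simp
      have "v' \<bullet> (X *v (u - u')) \<le> norm v' * norm (X *v (u - u'))" by (rule norm_cauchy_schwarz)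
      also have "\<dots> \<le> 1 * (spectral_norm X * norm (u - u'))"
        unfolding n1 using spectral_norm_apply by (intro mult_left_mono) auto
      also have "\<dots> \<le> spectral_norm X * e"
        using uv' spectral_norm_nonneg[of X] by (simp add: mult_left_mono)
      finally have 2: "v' \<bullet> (X *v (u - u')) \<le> e * spectral_norm X" by (simp add: mult.commute)
      have "v' \<bullet> (X *v u') = v \<bullet> (X *v u) - (v - v') \<bullet> (X *v u) - v' \<bullet> (X *v (u - u'))"
        by (simp add: inner_diff_left inner_diff_right matrix_vector_mult_diff_distrib)
      then have "(1 - 2 * e) * spectral_norm X \<le> outer_prod v' u' \<bullet> X"
        using 1 2 uv(3) by (simp add: outer_prod_inner algebra_simps)
      then show ?thesis using uv' by (intro bexI[of _ "(v', u')"]) auto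
    qed
    have "(\<integral>X. (1 - 2 * e) * spectral_norm X \<partial>(std_gaussian :: (real ^ 'k ^ 'n) measure))
       \<le> (\<integral>z. norm (fst z) + norm (snd z) \<partial>(std_gaussian :: ((real ^ 'n) \<times> (real ^ 'k)) measure))"
    \<comment> \<open>With \<open>b\<close> the identity, the comparison process is
      \<open>v \<bullet> g + u \<bullet> h\<close> for a Gaussian pair \<open>(g, h)\<close>. Over
      unit vectors it is at most the sum of the two norms, which do not depend on the net.\<close>
    proof (rule sudakov_fernique[where T="V \<times> U" and a="\<lambda>t. outer_prod (fst t) (snd t)" and b="\<lambda>t. t"])
      show "V \<times> U \<noteq> {}" using ex by blast
      show "integrable std_gaussian (\<lambda>X :: real ^ 'k ^ 'n. (1 - 2 * e) * spectral_norm X)"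
        by (intro integrable_mult_right spectral_norm_integrable)
      show "integrable std_gaussian (\<lambda>z :: (real ^ 'n) \<times> (real ^ 'k). norm (fst z) + norm (snd z))"
        by (rule std_gaussian_prod_norm_le(2))
      fix s t assume "s \<in> V \<times> U" "t \<in> V \<times> U"
      then have "norm (fst s) = 1" "norm (snd s) = 1" "norm (fst t) = 1" "norm (snd t) = 1" using V U by auto
      then show "norm (outer_prod (fst s) (snd s) - outer_prod (fst t) (snd t)) \<le> norm (s - t)"
        using outer_prod_increment_le[of "snd s" "fst s" "snd t" "fst t"] by simp
    next
      fix z t :: "(real ^ 'n) \<times> (real ^ 'k)" assume "t \<in> V \<times> U"
      then have t: "norm (fst t) = 1" "norm (snd t) = 1" using V U by auto
      show "t \<bullet> z \<le> norm (fst z) + norm (snd z)"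
        using norm_cauchy_schwarz[of "fst t" "fst z"] norm_cauchy_schwarz[of "snd t" "snd z"] t
        by (simp add: inner_prod_def)
    qed (use V U ex in auto)
    also have "\<dots> \<le> sqrt (real DIM(real^'n)) + sqrt (real DIM(real^'k))" by (rule std_gaussian_prod_norm_le(1))
    finally show ?thesis by (simp add: E_def B_def)
  qed
  have "((\<lambda>e. (1 - 2 * e) * E) \<longlongrightarrow> (1 - 2 * 0) * E) (at_right 0)" by (intro tendsto_intros)
  moreover have "eventually (\<lambda>e. (1 - 2 * e) * E \<le> B) (at_right 0)"
    unfolding eventually_at_right_field using main by (intro exI[of _ 1]) auto
  ultimately have "(1 - 2 * 0) * E \<le> B"
    by (intro tendsto_upperbound[of _ _ "at_right 0"]) auto
  then show ?thesis by (simp add: E_def B_def)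
qed

section \<open>The Stiefel manifold\<close>

declare transpose_matrix_vector [simp del]

lemma inner_transpose_mult: "(transpose A *v x) \<bullet> y = x \<bullet> (A *v y)" for A :: "real ^ 'k ^ 'n"
  by (simp add: transpose_matrix_vector dot_lmul_matrix)

text \<open>Polarization recovers inner products from norms. Membership can then be checked on
  vectors, which makes closedness and products immediate.\<close>

lemma stiefel_iff_isometry: "Q \<in> stiefel \<longleftrightarrow> (\<forall>x. norm (Q *v x) = norm x)" for Q :: "real ^ 'k ^ 'n"
proof -
  have "transpose Q ** Q = mat 1 \<longleftrightarrow> (\<forall>x y. (Q *v x) \<bullet> (Q *v y) = x \<bullet> y)"
  proof
    assume "transpose Q ** Q = mat 1"
    then show "\<forall>x y. (Q *v x) \<bullet> (Q *v y) = x \<bullet> y"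
      by (simp add: inner_transpose_mult[symmetric] matrix_vector_mul_assoc)
  next
    assume *: "\<forall>x y. (Q *v x) \<bullet> (Q *v y) = x \<bullet> y"
    have "(transpose Q ** Q) *v y = mat 1 *v y" for y
    proof -
      have "x \<bullet> ((transpose Q ** Q) *v y) = x \<bullet> y" for x
        using * inner_transpose_mult[of Q "Q *v y" x]
        by (simp add: matrix_vector_mul_assoc[symmetric] inner_commute)
      then show ?thesis by (metis matrix_vector_mul_lid vector_eq_ldot)
    qed
    then show "transpose Q ** Q = mat 1" by (simp add: matrix_eq)
  qed
  also have "\<dots> \<longleftrightarrow> (\<forall>x. norm (Q *v x) = norm x)"
  proof
    assume "\<forall>x y. (Q *v x) \<bullet> (Q *v y) = x \<bullet> y"
    then show "\<forall>x. norm (Q *v x) = norm x" by (simp add: norm_eq_sqrt_inner)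
  next
    assume *: "\<forall>x. norm (Q *v x) = norm x"
    show "\<forall>x y. (Q *v x) \<bullet> (Q *v y) = x \<bullet> y"
      unfolding dot_norm matrix_vector_right_distrib[symmetric] using * by simp
  qed
  finally show ?thesis by (simp add: stiefel_def)
qed

lemma stiefel_transpose_mult: "Q \<in> stiefel \<Longrightarrow> transpose Q *v (Q *v x) = x"
  by (simp add: stiefel_def matrix_vector_mul_assoc)

lemma orthogonal_matrix_stiefel: "orthogonal_matrix U \<longleftrightarrow> U \<in> stiefel"
  by (simp add: orthogonal_matrix stiefel_def)

lemma stiefel_mult: "U \<in> stiefel \<Longrightarrow> Q \<in> stiefel \<Longrightarrow> U ** Q \<in> stiefel"
  by (simp add: stiefel_iff_isometry matrix_vector_mul_assoc[symmetric])

lemma norm_matrix_columns: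
  fixes A :: "real ^ 'k ^ 'n"
  shows "(norm A)\<^sup>2 = (\<Sum>j\<in>UNIV. (norm (column j A))\<^sup>2)"
  unfolding power2_norm_eq_inner inner_vec_def column_def by (simp) (rule sum.swap)

lemma column_matrix_mult: "column j (A ** B) = A *v column j B"
  by (simp add: vec_eq_iff column_def matrix_matrix_mult_def matrix_vector_mult_def)

text \<open>\<open>U\<close> acts on every column separately, and the squared norm of a matrix is
  the sum over its columns. Left translation therefore preserves the standard Gaussian law on
  matrices.\<close>

lemma orthogonal_transformation_left_mult:
  fixes U :: "real ^ 'n ^ 'n"
  assumes "orthogonal_matrix U"
  shows "orthogonal_transformation (\<lambda>A :: real ^ 'k ^ 'n. U ** A)"
  unfolding orthogonal_transformation
proof (intro conjI allI)
  show "linear (\<lambda>A :: real ^ 'k ^ 'n. U ** A)"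
    by (rule linearI) (simp_all add: matrix_add_ldistrib matrix_scalar_ac scalar_matrix_assoc flip: scalar_mult_eq_scaleR)
  fix A :: "real ^ 'k ^ 'n"
  have "(norm (U ** A))\<^sup>2 = (norm A)\<^sup>2"
    using assms by (simp add: norm_matrix_columns column_matrix_mult orthogonal_matrix_stiefel stiefel_iff_isometry)
  then show "norm (U ** A) = norm A" by simp
qed

lemma bounded_stiefel: "bounded (stiefel :: (real ^ 'k ^ 'n) set)"
proof (rule boundedI)
  fix Q :: "real ^ 'k ^ 'n" assume "Q \<in> stiefel"
  then have "(norm (column j Q))\<^sup>2 = 1" for j
    by (metis matrix_vector_mul_component stiefel_iff_isometry matrix_vector_mult_basis norm_axis_1 one_power2)
  then have "(norm Q)\<^sup>2 = real CARD('k)"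
    by (simp add: norm_matrix_columns)
  then show "norm Q \<le> sqrt (real CARD('k))" by (simp add: real_le_rsqrt)
qed

lemma closed_stiefel: "closed (stiefel :: (real ^ 'k ^ 'n) set)"
proof -
  have "stiefel = (\<Inter>x. {Q :: real ^ 'k ^ 'n. norm (Q *v x) = norm x})"
    using stiefel_iff_isometry by blast
  also have "closed \<dots>"
    by (intro closed_INT ballI closed_Collect_eq continuous_intros linear_continuous_on)
       (auto simp: linear_conv_bounded_linear[symmetric] intro!: linearI
         simp: matrix_vector_mult_add_rdistrib scaleR_matrix_vector_assoc)
  finally show ?thesis .
qed

lemma compact_stiefel: "compact (stiefel :: (real ^ 'k ^ 'n) set)"
  using bounded_stiefel closed_stiefel compact_eq_bounded_closed by blast

text \<open>The range of \<open>A\<close> has dimension at most \<open>CARD('k)\<close>, hence lies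
  in a subspace of exactly that dimension. An isometry from the domain onto this subspace gives
  \<open>Q\<close>, and \<open>R = transpose Q ** A\<close> undoes it. No rank condition on
  \<open>A\<close> arises, because the subspace may be larger than the range. Since \<open>Q\<close>
  is an isometry, \<open>R\<close> and \<open>A\<close> stretch every vector equally.\<close>

lemma stiefel_factorization:
  fixes A :: "real ^ 'k ^ 'n"
  assumes kn: "CARD('k) \<le> CARD('n)"
  obtains Q :: "real ^ 'k ^ 'n" and R :: "real ^ 'k ^ 'k"
  where "Q \<in> stiefel" "A = Q ** R" "spectral_norm R = spectral_norm A"
proof -
  define S where "S = range ((*v) A)"
  have sS: "subspace S" unfolding S_def by (intro linear_subspace_image) auto
  obtain B where B: "B \<subseteq> S" "independent B" "S \<subseteq> span B" "card B = dim S" by (rule basis_exists)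
  have "dim S \<le> dim (UNIV :: (real^'k) set)" unfolding S_def by (intro dim_image_le) auto
  then have cB: "card B \<le> CARD('k)" using B by simp
  obtain C where C: "B \<subseteq> C" "C \<subseteq> UNIV" "independent C" "UNIV \<subseteq> span C"
    by (rule maximal_independent_subset_extend[OF subset_UNIV B(2)])
  have "dim (span C) = card C" using C(3) by (rule dim_span_eq_card_independent)
  moreover have "span C = UNIV" using C(4) by auto
  ultimately have "card C = CARD('n)" by (metis DIM_cart DIM_real dim_UNIV mult.right_neutral)
  moreover have "finite C" using C(3) by (rule finiteI_independent)
  \<comment> \<open>A basis \<open>B\<close> of the range has at most \<open>CARD('k)\<close>
    elements and the full basis \<open>C\<close> has \<open>CARD('n)\<close>; an independent set of
    intermediate size lies between them.\<close>
  ultimately obtain D where D: "B \<subseteq> D" "D \<subseteq> C" "card D = CARD('k)"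
    using exists_subset_between[of B "CARD('k)" C] cB kn C(1) by auto
  have "dim (span D) = card D" using independent_mono[OF C(3) D(2)] by (rule dim_span_eq_card_independent)
  then have "dim (UNIV :: (real^'k) set) = dim (span D)" using D by simp
  then obtain f :: "real^'k \<Rightarrow> real^'n" where f: "linear f" "range f = span D" "\<And>x. norm (f x) = norm x"
    by (rule isometries_subspaces[OF subspace_UNIV subspace_span]) (rule that, auto)
  define Q where "Q = matrix f"
  have Qf: "Q *v x = f x" for x using f(1) by (simp add: Q_def matrix_works)
  have Q: "Q \<in> stiefel" unfolding stiefel_iff_isometry Qf using f by simp
  define R where "R = transpose Q ** A"
  have R: "Q *v (R *v x) = A *v x" for x
  proof -
    have "A *v x \<in> span D" using B(3) D(1) span_mono[of B D] by (auto simp: S_def)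
    then obtain w where "A *v x = Q *v w" unfolding f(2)[symmetric] Qf by blast
    then show ?thesis
      using stiefel_transpose_mult[OF Q] by (simp add: R_def matrix_vector_mul_assoc[symmetric])
  qed
  show ?thesis
  proof
    show "Q \<in> stiefel" by (rule Q)
    show "A = Q ** R" unfolding matrix_eq using R by (simp add: matrix_vector_mul_assoc[symmetric])
    have "norm (R *v x) = norm (A *v x)" for x
      using Q R[of x] unfolding stiefel_iff_isometry by metis
    then show "spectral_norm R = spectral_norm A" by (simp add: spectral_norm_def onorm_def)
  qed
qed

text \<open>\<open>Q ** transpose P\<close> carries the range of \<open>P\<close> isometrically to
  that of \<open>Q\<close>. The orthogonal complements of the ranges are the kernels
  \<open>K P\<close> and \<open>K Q\<close>; they have equal dimension, so an isometry between them
  completes this to an orthogonal map.\<close>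

lemma stiefel_transitive:
  fixes P Q :: "real ^ 'k ^ 'n"
  assumes P: "P \<in> stiefel" and Q: "Q \<in> stiefel"
  obtains U where "orthogonal_matrix U" "U ** P = Q"
proof -
  define K where "K = (\<lambda>P :: real ^ 'k ^ 'n. {x. transpose P *v x = 0})"
  have perp: "(W *v z) \<bullet> x = 0" if "x \<in> K W" for W x z
    using that inner_transpose_mult[of W x z] by (simp add: K_def inner_commute)
  have sK: "subspace (K W)" for W
    by (auto simp: K_def subspace_def matrix_vector_right_distrib matrix_vector_mult_scaleR)
  have dK: "dim (K W) + CARD('k) = CARD('n)" if "W \<in> stiefel" for W
  proof -
    have "inj ((*v) W)"
      using that by (metis injI stiefel_transpose_mult)
    then have "dim (range ((*v) W)) = CARD('k)"
      using dim_image_eq[of "(*v) W" UNIV] by (simp add: inj_on_subset)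
    moreover have "K W = {y \<in> UNIV. \<forall>x\<in>range ((*v) W). orthogonal x y}"
    proof (intro set_eqI iffI)
      fix y assume "y \<in> K W" then show "y \<in> {y \<in> UNIV. \<forall>x\<in>range ((*v) W). orthogonal x y}"
        using perp by (auto simp: orthogonal_def)
    next
      fix y assume "y \<in> {y \<in> UNIV. \<forall>x\<in>range ((*v) W). orthogonal x y}"
      then have "(W *v z) \<bullet> y = 0" for z by (auto simp: orthogonal_def)
      then have "z \<bullet> (transpose W *v y) = 0" for z
        using inner_transpose_mult[of W y z] by (simp add: inner_commute)
      then show "y \<in> K W" by (simp add: K_def) (metis inner_eq_zero_iff)
    qed
    moreover have "subspace (range ((*v) W))" by (intro linear_subspace_image) auto
    ultimately show ?thesis
      using dim_subspace_orthogonal_to_vectors[of "range ((*v) W)" UNIV] by simp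
  qed
  obtain f where f: "linear f" "f ` K P = K Q" "\<And>x. x \<in> K P \<Longrightarrow> norm (f x) = norm x"
    using isometries_subspaces[OF sK sK, of P Q] dK[OF P] dK[OF Q] by (metis add_right_cancel)
  \<comment> \<open>Split \<open>x\<close> into its projection
    \<open>P *v (transpose P *v x)\<close> and the rest in \<open>K P\<close>, and move the two
    parts separately. Pythagoras before and after shows that norms are kept.\<close>
  define h where "h = (\<lambda>x. Q *v (transpose P *v x) + f (x - P *v (transpose P *v x)))"
  have lin: "linear h" unfolding h_def
    by (intro linearI) (simp_all add: linear_add[OF f(1)] linear_diff[OF f(1)] linear_scale[OF f(1)]
        matrix_vector_right_distrib matrix_vector_mult_scaleR algebra_simps)
  have inK: "x - P *v (transpose P *v x) \<in> K P" for x
    using stiefel_transpose_mult[OF P] by (simp add: K_def matrix_vector_mult_diff_distrib)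
  have "norm (h x) = norm x" for x
  proof -
    let ?y = "transpose P *v x" and ?z = "x - P *v (transpose P *v x)"
    have "f ?z \<in> K Q" using inK f(2) by blast
    then have "(norm (h x))\<^sup>2 = (norm (Q *v ?y))\<^sup>2 + (norm (f ?z))\<^sup>2"
      unfolding h_def by (intro norm_add_Pythagorean) (simp add: orthogonal_def perp)
    also have "\<dots> = (norm (P *v ?y))\<^sup>2 + (norm ?z)\<^sup>2"
      using P Q f(3)[OF inK] by (simp add: stiefel_iff_isometry)
    also have "\<dots> = (norm (P *v ?y + ?z))\<^sup>2"
      using perp[OF inK] by (intro norm_add_Pythagorean[symmetric]) (simp add: orthogonal_def)
    finally show ?thesis by simp
  qed
  then have "matrix h \<in> stiefel" using lin by (simp add: stiefel_iff_isometry matrix_works)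
  moreover have "matrix h ** P = Q"
    unfolding matrix_eq using stiefel_transpose_mult[OF P] linear_0[OF f(1)] lin
    by (simp add: matrix_vector_mul_assoc[symmetric] matrix_works h_def)
  ultimately show ?thesis using that orthogonal_matrix_stiefel by blast
qed

section \<open>Averaging over the orthogonal group\<close>

text \<open>If the best uniform upper bound over \<open>F\<close> exceeded \<open>c0 + e\<close>, take a nearly optimal \<open>f\<close>. It is
  small on a ball whose radius depends only on \<open>C\<close> and \<open>e\<close>; boundedly many translates of this ball
  cover \<open>S\<close>, so averaging the corresponding translates of \<open>f\<close> lowers the bound by a fixed amount.\<close>

lemma orbit_averaging:
  fixes S :: "'a::metric_space set" and F :: "('a \<Rightarrow> real) set" and G :: "('a \<Rightarrow> 'a) set"
  assumes S: "compact S"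
    and trans: "\<And>x y. x \<in> S \<Longrightarrow> y \<in> S \<Longrightarrow> \<exists>g\<in>G. g x = y"
    and iso: "\<And>g x y. g \<in> G \<Longrightarrow> x \<in> S \<Longrightarrow> y \<in> S \<Longrightarrow> dist (g x) (g y) = dist x y"
    and maps: "\<And>g x. g \<in> G \<Longrightarrow> x \<in> S \<Longrightarrow> g x \<in> S"
    and F0: "\<phi> \<in> F"
    and avg: "\<And>f K h. f \<in> F \<Longrightarrow> finite K \<Longrightarrow> K \<noteq> {} \<Longrightarrow> K \<subseteq> S \<Longrightarrow> h ` K \<subseteq> G
       \<Longrightarrow> (\<lambda>x. (\<Sum>i\<in>K. f (h i x)) / real (card K)) \<in> F"
    and C: "C > 0"
    and lip: "\<And>f x y. f \<in> F \<Longrightarrow> x \<in> S \<Longrightarrow> y \<in> S \<Longrightarrow> \<bar>f x - f y\<bar> \<le> C * dist x y"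
    and low: "\<And>f. f \<in> F \<Longrightarrow> \<exists>x\<in>S. f x \<le> c0"
    and e: "e > 0"
  shows "\<exists>f\<in>F. \<forall>x\<in>S. f x \<le> c0 + e"
proof (rule ccontr)
  assume neg: "\<not> ?thesis"
  \<comment> \<open>All uniform upper bounds on \<open>S\<close> that some member of
    \<open>F\<close> achieves. Its infimum will be undercut.\<close>
  define I where "I = {c. \<exists>f\<in>F. \<forall>x\<in>S. f x \<le> c}"
  have I_ge: "c0 + e \<le> c" if "c \<in> I" for c
  proof (rule ccontr)
    assume "\<not> c0 + e \<le> c"
    then show False using that neg unfolding I_def by (force intro: order_trans)
  qed
  have bdd: "bdd_below I" using I_ge by (rule bdd_belowI)
  obtain x0 where x0: "x0 \<in> S" "\<phi> x0 \<le> c0" using low[OF F0] by blast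
  have "\<phi> x \<le> c0 + C * diameter S" if "x \<in> S" for x
  proof -
    have "C * dist x x0 \<le> C * diameter S"
      using C diameter_bounded_bound[OF compact_imp_bounded[OF S] that x0(1)] by (simp add: mult_left_mono)
    then show ?thesis using lip[OF F0 that x0(1)] x0(2) by simp
  qed
  then have "I \<noteq> {}" using F0 unfolding I_def by blast
  \<comment> \<open>Moving by less than \<open>r\<close> changes any member of \<open>F\<close> by
    at most \<open>e / 2\<close>, so near a point with value at most \<open>c0\<close> half of the
    excess \<open>e\<close> remains.\<close>
  define r where "r = e / (2 * C)"
  have r: "r > 0" "C * r = e / 2" using e C by (simp_all add: r_def)
  have "\<exists>K. finite K \<and> K \<subseteq> S \<and> S \<subseteq> (\<Union>x\<in>K. ball x r)"
    using seq_compact_imp_totally_bounded[OF compact_imp_seq_compact[OF S]] r(1) by auto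
  \<comment> \<open>The cover is fixed before \<open>f\<close> is chosen, so its size
    \<open>m\<close>, and with it the gain \<open>e / (2 * m)\<close>, does not depend on
    \<open>f\<close>.\<close>
  then obtain K where K: "finite K" "K \<subseteq> S" "S \<subseteq> (\<Union>x\<in>K. ball x r)" by blast
  have "K \<noteq> {}" using K(3) x0(1) by blast
  define m where "m = real (card K)"
  have m: "m > 0" using K(1) \<open>K \<noteq> {}\<close> by (simp add: m_def card_gt_0_iff)
  \<comment> \<open>Optimal up to exactly the gain that averaging will produce.\<close>
  obtain c where c: "c \<in> I" "c < Inf I + e / (2 * m)"
    using cInf_lessD[OF \<open>I \<noteq> {}\<close>, of "Inf I + e / (2 * m)"] e m by auto
  obtain f where f: "f \<in> F" "\<And>x. x \<in> S \<Longrightarrow> f x \<le> c" using c(1) unfolding I_def by blast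
  obtain z where z: "z \<in> S" "f z \<le> c0" using low[OF f(1)] by blast
  \<comment> \<open>Each centre \<open>p\<close> is moved to the point \<open>z\<close> where
    \<open>f\<close> is small, so the translate of \<open>f\<close> by \<open>h p\<close> is small
    on the ball around \<open>p\<close>.\<close>
  have "\<forall>p\<in>K. \<exists>g\<in>G. g p = z" using trans z(1) K(2) by blast
  then obtain h where h: "\<And>p. p \<in> K \<Longrightarrow> h p \<in> G" "\<And>p. p \<in> K \<Longrightarrow> h p p = z" by metis
  define f' where "f' = (\<lambda>x. (\<Sum>i\<in>K. f (h i x)) / real (card K))"
  have "f' \<in> F" unfolding f'_def using h(1) by (intro avg f(1) K(1,2) \<open>K \<noteq> {}\<close>) auto
  moreover have "f' x \<le> c - e / (2 * m)" if x: "x \<in> S" for x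
  proof -
    obtain p where p: "p \<in> K" "dist p x < r" using K(3) x by auto
    have pS: "p \<in> S" using p K by blast
    have "dist (h p x) z = dist x p" using iso[OF h(1)[OF p(1)] x pS] h(2)[OF p(1)] by simp
    then have "C * dist (h p x) z \<le> C * r" using p(2) C by (simp add: dist_commute mult_left_mono)
    then have "f (h p x) \<le> c0 + e / 2"
      using lip[OF f(1) maps[OF h(1)[OF p(1)] x] z(1)] z(2) r(2) by simp
    moreover have "(\<Sum>i\<in>K - {p}. f (h i x)) \<le> (\<Sum>i\<in>K - {p}. c)"
      by (rule sum_mono) (use maps[OF h(1) x] f(2) in blast)
    moreover have "(\<Sum>i\<in>K - {p}. c) = (m - 1) * c"
      using p(1) K(1) m by (simp add: m_def of_nat_diff Suc_leI card_gt_0_iff)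
    \<comment> \<open>At every \<open>x\<close> at least one of the \<open>m\<close> translates is
      at most \<open>c0 + e / 2\<close> and the others are at most \<open>c\<close>. As
      \<open>c0 + e \<le> c\<close>, the sum falls short of \<open>m * c\<close> by at least
      \<open>e / 2\<close>.\<close>
    ultimately have "(\<Sum>i\<in>K. f (h i x)) \<le> c0 + e / 2 + (m - 1) * c"
      using sum.remove[OF K(1) p(1), of "\<lambda>i. f (h i x)"] by linarith
    also have "\<dots> \<le> m * c - e / 2" using I_ge[OF c(1)] by (simp add: algebra_simps)
    finally have "f' x \<le> (m * c - e / 2) / m"
      using m by (simp add: f'_def m_def[symmetric] divide_right_mono)
    also have "\<dots> = c - e / (2 * m)" using m by (simp add: field_simps)
    finally show ?thesis .
  qed
  ultimately have "c - e / (2 * m) \<in> I" unfolding I_def by blast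
  then have "Inf I \<le> c - e / (2 * m)" using bdd by (rule cInf_lower)
  with c(2) show False by simp
qed

section \<open>Left translates of an ideal norm\<close>

lemma uniform_on_stiefel_measurable:
  assumes "uniform_on_stiefel M Q"
  shows "Q \<in> borel_measurable M" and "\<And>\<omega>. \<omega> \<in> space M \<Longrightarrow> Q \<omega> \<in> stiefel"
  using assms by (auto simp: uniform_on_stiefel_def measurable_restrict_space2_iff)

text \<open>Haar invariance with the right factor \<open>mat 1\<close>, pulled back from the law of
  \<open>Q\<close> to \<open>M\<close>.\<close>

lemma uniform_on_stiefel_integral_left_mult:
  fixes Q :: "'a \<Rightarrow> real ^ 'k ^ 'n" and f :: "real ^ 'k ^ 'n \<Rightarrow> real"
  assumes Q: "uniform_on_stiefel M Q" and U: "orthogonal_matrix U"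
    and f: "f \<in> borel_measurable borel"
  shows "(\<integral>\<omega>. f (U ** Q \<omega>) \<partial>M) = (\<integral>\<omega>. f (Q \<omega>) \<partial>M)"
proof -
  let ?B = "restrict_space borel (stiefel :: (real ^ 'k ^ 'n) set)"
  let ?T = "\<lambda>X :: real ^ 'k ^ 'n. U ** X ** mat 1"
  define \<mu> where "\<mu> = distr M ?B Q"
  have Qm: "Q \<in> measurable M ?B" using Q by (simp add: uniform_on_stiefel_def)
  have inv: "distr \<mu> \<mu> ?T = \<mu>"
    using Q U orthogonal_matrix_id unfolding uniform_on_stiefel_def haar_stiefel_def \<mu>_def by blast
  have "linear (\<lambda>X :: real ^ 'k ^ 'n. U ** X)"
    using orthogonal_transformation_left_mult[OF U] by (rule orthogonal_transformation_linear)
  then have "(\<lambda>X :: real ^ 'k ^ 'n. U ** X) \<in> borel_measurable borel"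
    by (intro borel_measurable_continuous_onI linear_continuous_on) (simp add: linear_conv_bounded_linear)
  then have "?T \<in> measurable ?B ?B"
    using U by (intro measurable_restrict_space3) (auto simp: stiefel_mult orthogonal_matrix_stiefel)
  then have T: "?T \<in> measurable \<mu> \<mu>" by (simp add: \<mu>_def)
  have fB: "f \<in> borel_measurable ?B" using f by (rule measurable_restrict_space1)
  then have f\<mu>: "f \<in> borel_measurable \<mu>" by (simp add: \<mu>_def)
  have fT: "(\<lambda>X. f (?T X)) \<in> borel_measurable ?B"
    using measurable_compose[OF T f\<mu>] by (simp add: \<mu>_def)
  have "(\<integral>\<omega>. f (U ** Q \<omega>) \<partial>M) = (\<integral>X. f (?T X) \<partial>\<mu>)"
    unfolding \<mu>_def by (subst integral_distr[OF Qm fT]) simp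
  also have "\<dots> = (\<integral>X. f X \<partial>distr \<mu> \<mu> ?T)" by (rule integral_distr[OF T f\<mu>, symmetric])
  also have "\<dots> = (\<integral>\<omega>. f (Q \<omega>) \<partial>M)"
    unfolding inv unfolding \<mu>_def by (rule integral_distr[OF Qm fB])
  finally show ?thesis .
qed

text \<open>The averaging principle is applied to a class of functions containing \<open>N\<close>
  and closed under averages of left translates. Left translation commutes with the right
  multiplication in the ideal property, is an isometry, and preserves both expectations.\<close>

lemma averaged_ideal_norm:
  fixes Q :: "'a \<Rightarrow> real ^ 'k ^ 'n" and N :: "real ^ 'k ^ 'n \<Rightarrow> real"
  assumes M: "prob_space M" and Q: "uniform_on_stiefel M Q"
    and ideal: "\<And>A B. N (A ** B) \<le> N A * spectral_norm B"
    and C: "C > 0" and lip: "\<And>X Y. \<bar>N X - N Y\<bar> \<le> C * dist X Y"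
    and e: "e > 0"
  obtains f :: "real ^ 'k ^ 'n \<Rightarrow> real" where "\<And>A B. f (A ** B) \<le> f A * spectral_norm B"
    "\<And>X Y. \<bar>f X - f Y\<bar> \<le> C * dist X Y"
    "(\<integral>X. f X \<partial>std_gaussian) = (\<integral>X. N X \<partial>std_gaussian)"
    "\<And>X. X \<in> stiefel \<Longrightarrow> f X \<le> (\<integral>\<omega>. N (Q \<omega>) \<partial>M) + e"
proof -
  interpret prob_space M by (rule M)
  note Qm[measurable] = uniform_on_stiefel_measurable(1)[OF Q]
  define c0 where "c0 = (\<integral>\<omega>. N (Q \<omega>) \<partial>M)"
  define G where "G = (\<lambda>U (X :: real ^ 'k ^ 'n). U ** X) ` {U. orthogonal_matrix U}"
  \<comment> \<open>Everything that must survive averaging. The triangle inequality is not among it: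
    measurability and integrability come from the Lipschitz bound, with the same constant
    \<open>C\<close> for all members.\<close>
  define F where "F = {f :: real ^ 'k ^ 'n \<Rightarrow> real. (\<forall>A B. f (A ** B) \<le> f A * spectral_norm B)
     \<and> (\<forall>X Y. \<bar>f X - f Y\<bar> \<le> C * dist X Y)
     \<and> (\<integral>\<omega>. f (Q \<omega>) \<partial>M) = c0 \<and> (\<integral>X. f X \<partial>std_gaussian) = (\<integral>X. N X \<partial>std_gaussian)}"
  have Giso: "dist (g X) (g Y) = dist X Y" if gG: "g \<in> G" for g X Y
  proof -
    obtain U where U: "orthogonal_matrix U" "g = (\<lambda>X. U ** X)" using gG by (auto simp: G_def)
    note o = orthogonal_transformation_left_mult[where 'k='k, OF U(1)]
    show ?thesis unfolding U(2) dist_norm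
      using linear_diff[OF orthogonal_transformation_linear[OF o], of X Y] orthogonal_transformation_norm[OF o]
      by metis
  qed
  have Fc: "continuous_on A f" if "f \<in> F" for f A
    using that C by (intro Lipschitz_continuous_on[of C]) (auto simp: F_def)
  have Fm: "f \<in> borel_measurable borel" if "f \<in> F" for f
    using Fc[OF that] by (rule borel_measurable_continuous_onI)
  have FiQ: "integrable M (\<lambda>\<omega>. f (Q \<omega>))" if "f \<in> F" for f
  proof -
    have "bounded (f ` stiefel)"
      using Fc[OF that] compact_stiefel by (intro compact_imp_bounded compact_continuous_image)
    then obtain B where "\<And>X. X \<in> stiefel \<Longrightarrow> norm (f X) \<le> B" by (auto simp: bounded_iff)
    then show ?thesis using uniform_on_stiefel_measurable[OF Q] Fm[OF that]
      by (intro integrable_const_bound[where B=B]) auto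
  qed
  have "\<exists>f\<in>F. \<forall>X\<in>stiefel. f X \<le> c0 + e"
  proof (rule orbit_averaging[where C=C and G=G and \<phi>=N])
    show "compact (stiefel :: (real ^ 'k ^ 'n) set)" by (rule compact_stiefel)
    show "\<exists>g\<in>G. g X = Y" if XY: "X \<in> stiefel" "Y \<in> stiefel" for X Y
    proof -
      obtain U where "orthogonal_matrix U" "U ** X = Y" by (rule stiefel_transitive[OF XY])
      then show ?thesis by (auto simp: G_def)
    qed
    show "dist (g X) (g Y) = dist X Y" if "g \<in> G" for g X Y by (rule Giso[OF that])
    show "g X \<in> stiefel" if "g \<in> G" "X \<in> stiefel" for g X
      using that by (auto simp: G_def orthogonal_matrix_stiefel stiefel_mult)
    show "N \<in> F" using ideal lip by (simp add: F_def c0_def)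
    show "C > 0" "e > 0" by fact+
    show "\<bar>f X - f Y\<bar> \<le> C * dist X Y" if "f \<in> F" for f X Y using that by (simp add: F_def)
    \<comment> \<open>A continuous function on a compact set attains its minimum, which cannot
      exceed the mean \<open>c0\<close> of \<open>f (Q \<omega>)\<close>.\<close>
    show "\<exists>X\<in>stiefel. f X \<le> c0" if f: "f \<in> F" for f
    proof -
      have "(stiefel :: (real ^ 'k ^ 'n) set) \<noteq> {}"
        using uniform_on_stiefel_measurable(2)[OF Q] not_empty by blast
      then obtain X where X: "X \<in> stiefel" "\<And>Y. Y \<in> stiefel \<Longrightarrow> f X \<le> f Y"
        using continuous_attains_inf[OF compact_stiefel _ Fc[OF f]] by blast
      have "(\<integral>\<omega>. f X \<partial>M) \<le> (\<integral>\<omega>. f (Q \<omega>) \<partial>M)"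
        using X(2) uniform_on_stiefel_measurable(2)[OF Q] FiQ[OF f] by (intro integral_mono) auto
      then show ?thesis using f X(1) prob_space by (auto simp: F_def)
    qed
    fix f and K :: "(real ^ 'k ^ 'n) set" and h
    assume f: "f \<in> F" and K: "finite K" "K \<noteq> {}" and h: "h ` K \<subseteq> G"
    have m: "real (card K) > 0" using K by (simp add: card_gt_0_iff)
    have "\<forall>i\<in>K. \<exists>U. orthogonal_matrix U \<and> h i = (\<lambda>X. U ** X)" using h by (auto simp: G_def)
    then obtain U where U: "\<And>i. i \<in> K \<Longrightarrow> orthogonal_matrix (U i)" "\<And>i. i \<in> K \<Longrightarrow> h i = (\<lambda>X. U i ** X)" by metis
    let ?f = "\<lambda>X. (\<Sum>i\<in>K. f (h i X)) / real (card K)"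
    have fU: "(\<lambda>X. f (U i ** X)) \<in> borel_measurable borel" if "i \<in> K" for i
    proof (intro borel_measurable_continuous_onI Lipschitz_continuous_on[of C])
      fix X Y :: "real ^ 'k ^ 'n"
      have "dist (U i ** X) (U i ** Y) = dist X Y" using Giso[of "h i" X Y] h that U(2)[OF that] by auto
      then show "\<bar>f (U i ** X) - f (U i ** Y)\<bar> \<le> C * dist X Y" using f by (auto simp: F_def) metis
    qed (use C in simp)
    have 1: "?f (A ** B) \<le> ?f A * spectral_norm B" for A B
    proof -
      have "(\<Sum>i\<in>K. f (h i (A ** B))) \<le> (\<Sum>i\<in>K. f (h i A) * spectral_norm B)"
        using f by (intro sum_mono) (auto simp: U(2) F_def matrix_mul_assoc)
      then show ?thesis using m by (simp add: sum_distrib_right[symmetric] divide_right_mono)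
    qed
    have 2: "\<bar>?f X - ?f Y\<bar> \<le> C * dist X Y" for X Y
    proof -
      have "\<bar>(\<Sum>i\<in>K. f (h i X)) - (\<Sum>i\<in>K. f (h i Y))\<bar> \<le> (\<Sum>i\<in>K. \<bar>f (h i X) - f (h i Y)\<bar>)"
        unfolding sum_subtractf[symmetric] by (rule sum_abs)
      also have "\<dots> \<le> (\<Sum>i\<in>K. C * dist X Y)"
      proof (rule sum_mono)
        fix i assume "i \<in> K"
        then have "dist (h i X) (h i Y) = dist X Y" using h Giso by blast
        moreover have "\<bar>f (h i X) - f (h i Y)\<bar> \<le> C * dist (h i X) (h i Y)" using f by (simp add: F_def)
        ultimately show "\<bar>f (h i X) - f (h i Y)\<bar> \<le> C * dist X Y" by simp
      qed
      also have "\<dots> = real (card K) * (C * dist X Y)" by simp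
      finally show ?thesis using m
        by (simp add: diff_divide_distrib[symmetric] abs_divide divide_le_eq mult.commute)
    qed
    have q: "(\<integral>\<omega>. f (U i ** Q \<omega>) \<partial>M) = c0" "integrable M (\<lambda>\<omega>. f (U i ** Q \<omega>))" if "i \<in> K" for i
    proof -
      show "(\<integral>\<omega>. f (U i ** Q \<omega>) \<partial>M) = c0"
        using uniform_on_stiefel_integral_left_mult[OF Q U(1)[OF that] Fm[OF f]] f by (simp add: F_def)
      have "bounded (f ` stiefel)"
        using Fc[OF f] compact_stiefel by (intro compact_imp_bounded compact_continuous_image)
      then obtain B where "\<And>X. X \<in> stiefel \<Longrightarrow> norm (f X) \<le> B" by (auto simp: bounded_iff)
      moreover have "U i ** Q \<omega> \<in> stiefel" if "\<omega> \<in> space M" for \<omega>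
        using that \<open>i \<in> K\<close> U(1) uniform_on_stiefel_measurable(2)[OF Q]
        by (intro stiefel_mult) (auto simp: orthogonal_matrix_stiefel)
      ultimately show "integrable M (\<lambda>\<omega>. f (U i ** Q \<omega>))"
        using measurable_compose[OF Qm fU[OF that]]
        by (intro integrable_const_bound[where B=B]) auto
    qed
    have 3: "(\<integral>\<omega>. ?f (Q \<omega>) \<partial>M) = c0"
      using q m by (simp add: U(2) Bochner_Integration.integral_sum)
    have o: "orthogonal_transformation (\<lambda>X :: real ^ 'k ^ 'n. U i ** X)" if "i \<in> K" for i
      using U(1)[OF that] by (rule orthogonal_transformation_left_mult)
    have g: "(\<integral>X. f (U i ** X) \<partial>std_gaussian) = (\<integral>X. N X \<partial>std_gaussian)" "integrable std_gaussian (\<lambda>X. f (U i ** X))"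
      if "i \<in> K" for i
    proof -
      show "(\<integral>X. f (U i ** X) \<partial>std_gaussian) = (\<integral>X. N X \<partial>std_gaussian)"
        using integral_std_gaussian_orthogonal[OF o[OF that] Fm[OF f]] f by (simp add: F_def)
      show "integrable std_gaussian (\<lambda>X. f (U i ** X))"
      proof (rule integrable_std_gaussian_linear_growth[OF fU[OF that]])
        show "\<bar>f (U i ** X)\<bar> \<le> \<bar>f 0\<bar> + C * norm X" for X
        proof -
          have "\<bar>f (U i ** X) - f 0\<bar> \<le> C * dist (U i ** X) 0" using f unfolding F_def by blast
          then show ?thesis using orthogonal_transformation_norm[OF o[OF that], of X] by simp
        qed
      qed (use C in simp)
    qed
    have 4: "(\<integral>X. ?f X \<partial>std_gaussian) = (\<integral>X. N X \<partial>std_gaussian)"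
      using g m by (simp add: U(2) Bochner_Integration.integral_sum)
    show "?f \<in> F" unfolding F_def mem_Collect_eq by (intro conjI allI 1 2 3 4)
  qed
  then obtain f where f: "f \<in> F" "\<And>X. X \<in> stiefel \<Longrightarrow> f X \<le> c0 + e" by blast
  show ?thesis
  proof (rule that[of f])
    show "f X \<le> (\<integral>\<omega>. N (Q \<omega>) \<partial>M) + e" if "X \<in> stiefel" for X
      using f(2)[OF that] by (simp add: c0_def)
    show "f (A ** B) \<le> f A * spectral_norm B" "\<bar>f X - f Y\<bar> \<le> C * dist X Y"
      "(\<integral>X. f X \<partial>std_gaussian) = (\<integral>X. N X \<partial>std_gaussian)" for A B X Y
      using f(1) unfolding F_def by blast+
  qed
qed

section \<open>The law of a normalized Gaussian matrix\<close>

text \<open>Sets are carried to the image index set by inverting \<open>f\<close> on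
  \<open>I\<close>. This serves to pass from entries indexed by pairs to coordinates indexed by
  basis matrices.\<close>

lemma (in prob_space) indep_sets_reindex:
  assumes inj: "inj_on f I" and ind: "indep_sets F (f ` I)"
  shows "indep_sets (\<lambda>i. F (f i)) I"
  unfolding indep_sets_def
proof (intro conjI ballI allI impI)
  show "F (f i) \<subseteq> events" if "i \<in> I" for i
    using ind that by (auto simp: indep_sets_def)
  fix J A assume J: "J \<subseteq> I" "J \<noteq> {}" "finite J" and A: "A \<in> (\<Pi> j\<in>J. F (f j))"
  define A' where "A' = (\<lambda>k. A (inv_into I f k))"
  have A': "A' (f j) = A j" if "j \<in> J" for j
    using that J inj by (auto simp: A'_def inv_into_f_f)
  have "prob (\<Inter>k\<in>f ` J. A' k) = (\<Prod>k\<in>f ` J. prob (A' k))"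
  proof (rule indep_setsD[OF ind])
    show "f ` J \<subseteq> f ` I" "f ` J \<noteq> {}" "finite (f ` J)" using J by auto
    show "\<forall>k\<in>f ` J. A' k \<in> F k" using A A' by auto
  qed
  moreover have "(\<Inter>k\<in>f ` J. A' k) = (\<Inter>j\<in>J. A j)" using A' by auto
  moreover have "(\<Prod>k\<in>f ` J. prob (A' k)) = (\<Prod>j\<in>J. prob (A j))"
    using A' inj_on_subset[OF inj J(1)] by (simp add: prod.reindex)
  ultimately show "prob (\<Inter>j\<in>J. A j) = (\<Prod>j\<in>J. prob (A j))" by simp
qed

lemma (in prob_space) indep_vars_reindex:
  assumes "inj_on f I" and "indep_vars M' X (f ` I)"
  shows "indep_vars (\<lambda>i. M' (f i)) (\<lambda>i. X (f i)) I"
  using assms(2) indep_sets_reindex[OF assms(1), of "\<lambda>i. sigma_sets (space M) {X i -` A \<inter> space M |A. A \<in> sets (M' i)}"]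
  by (simp add: indep_vars_def)

lemma normalized_gaussian_scaled_distr:
  fixes G :: "'b \<Rightarrow> real ^ 'k ^ 'n"
  assumes M: "prob_space M" and G: "normalized_gaussian M G"
  shows "distr M borel (\<lambda>\<omega>. sqrt (real CARD('n)) *\<^sub>R G \<omega>) = std_gaussian"
proof -
  interpret prob_space M by (rule M)
  define s where "s = sqrt (real CARD('n))"
  have s: "s > 0" by (simp add: s_def)
  have ind: "indep_vars (\<lambda>_. borel) (\<lambda>(i, j) \<omega>. G \<omega> $ i $ j) (UNIV :: ('n \<times> 'k) set)"
    and dist: "\<And>i j. distributed M lborel (\<lambda>\<omega>. G \<omega> $ i $ j) (normal_density 0 (1 / s))"
    using G by (auto simp: normalized_gaussian_def s_def)
  have basis: "\<exists>i j. b = axis i (axis j 1)" if "b \<in> Basis" for b :: "real ^ 'k ^ 'n"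
    using that by (auto simp: Basis_vec_def)
  \<comment> \<open>The pair of row and column in which a basis matrix has its entry 1; it
    determines the basis matrix, so \<open>ix\<close> is injective on \<open>Basis\<close>.\<close>
  define ix where "ix = (\<lambda>b :: real ^ 'k ^ 'n. SOME p. b = axis (fst p) (axis (snd p) 1))"
  have ix: "b = axis (fst (ix b)) (axis (snd (ix b)) 1)" if "b \<in> Basis" for b
  proof -
    have "\<exists>p. b = axis (fst p) (axis (snd p) 1)" using basis[OF that] by auto
    then show ?thesis unfolding ix_def by (rule someI_ex)
  qed
  have inj: "inj_on ix Basis" by (rule inj_onI) (metis ix)
  have co: "(s *\<^sub>R G \<omega>) \<bullet> b = s * (case ix b of (i, j) \<Rightarrow> G \<omega> $ i $ j)" if "b \<in> Basis" for b \<omega>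
    by (subst ix[OF that]) (simp add: inner_axis split_beta)
  have "distr M borel (\<lambda>\<omega>. s *\<^sub>R G \<omega>) = std_gaussian"
  proof (rule distr_eq_std_gaussianI)
    have "indep_vars (\<lambda>_. borel) (\<lambda>b \<omega>. case ix b of (i, j) \<Rightarrow> G \<omega> $ i $ j) Basis"
      using indep_vars_reindex[OF inj indep_vars_subset[OF ind subset_UNIV]] by (simp add: case_prod_beta')
    from indep_vars_compose2[OF this, of "\<lambda>_ x. s * x" "\<lambda>_. borel"]
    have "indep_vars (\<lambda>_. borel) (\<lambda>b \<omega>. s * (case ix b of (i, j) \<Rightarrow> G \<omega> $ i $ j)) Basis" by simp
    then show "indep_vars (\<lambda>_. borel) (\<lambda>b \<omega>. (s *\<^sub>R G \<omega>) \<bullet> b) Basis"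
      by (rule indep_vars_cong[THEN iffD1, rotated -1]) (auto simp only: co)
    show "distributed M lborel (\<lambda>\<omega>. (s *\<^sub>R G \<omega>) \<bullet> b) std_normal_density" if "b \<in> Basis" for b
      unfolding co[OF that]
      using normal_density_affine[OF dist[of "fst (ix b)" "snd (ix b)"], of s 0] s
      by (simp add: split_beta)
  qed
  then show ?thesis by (simp add: s_def)
qed

section \<open>Combination of averaging with Chevet's inequality\<close>

theorem theorem10:
  fixes M\<^sub>Q :: "'a measure" and M\<^sub>G :: "'b measure"
    and Q :: "'a \<Rightarrow> real ^ 'k ^ 'n" and G :: "'b \<Rightarrow> real ^ 'k ^ 'n"
    and N :: "real ^ 'k ^ 'n \<Rightarrow> real" and \<rho> :: real
  assumes "prob_space M\<^sub>Q" and "prob_space M\<^sub>G"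
    and "CARD('k) \<le> CARD('n)"
    and "0 < \<rho>" and "\<rho> \<le> 1" and "real CARD('k) = \<rho> * real CARD('n)"
    and "uniform_on_stiefel M\<^sub>Q Q"
    and "normalized_gaussian M\<^sub>G G"
    and "right_operator_ideal_norm N"
  shows "prob_space.expectation M\<^sub>G (\<lambda>\<omega>. N (G \<omega>))
         \<le> (1 + sqrt \<rho>) * prob_space.expectation M\<^sub>Q (\<lambda>\<omega>. N (Q \<omega>))"
proof -
  interpret Q: prob_space M\<^sub>Q by (rule assms(1))
  interpret G: prob_space M\<^sub>G by (rule assms(2))
  define n where "n = real CARD('n)"
  define k where "k = real CARD('k)"
  define c0 where "c0 = Q.expectation (\<lambda>\<omega>. N (Q \<omega>))"
  have n: "n > 0" by (simp add: n_def)
  have tri: "N (X + Y) \<le> N X + N Y" for X Y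
    using assms(9) by (simp add: right_operator_ideal_norm_def is_norm_def)
  have hom: "N (c *\<^sub>R X) = \<bar>c\<bar> * N X" for c X
    using assms(9) by (simp add: right_operator_ideal_norm_def is_norm_def)
  have ideal: "N (A ** B) \<le> N A * spectral_norm B" for A B
    using assms(9) by (simp add: right_operator_ideal_norm_def)
  obtain C where C: "C > 0" "\<And>X. N X \<le> C * norm X" "\<And>X Y. \<bar>N X - N Y\<bar> \<le> C * dist X Y"
    by (rule seminorm_bound[of N, OF tri hom]) (rule that)
  have Nm: "N \<in> borel_measurable borel"
    using C by (intro borel_measurable_continuous_onI Lipschitz_continuous_on[of C]) auto
  have Gm: "G \<in> borel_measurable M\<^sub>G"
  proof -
    have "(\<lambda>\<omega>. G \<omega> $ i $ j) \<in> borel_measurable M\<^sub>G" for i j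
      using assms(8) by (auto simp: normalized_gaussian_def distributed_def)
    then show ?thesis
      by (subst borel_measurable_euclidean_space) (auto simp: Basis_vec_def inner_axis)
  qed
  \<comment> \<open>Scaling by \<open>sqrt n\<close> makes the entries standard normal, and the norm
    is homogeneous.\<close>
  have gauss: "(\<integral>X. N X \<partial>std_gaussian) = sqrt n * G.expectation (\<lambda>\<omega>. N (G \<omega>))"
  proof -
    have "(\<integral>X. N X \<partial>std_gaussian) = G.expectation (\<lambda>\<omega>. N (sqrt n *\<^sub>R G \<omega>))"
      unfolding normalized_gaussian_scaled_distr[OF assms(2,8), symmetric] n_def
      using Gm Nm by (intro integral_distr) auto
    then show ?thesis using n by (simp add: hom)
  qed
  have bound: "sqrt n * G.expectation (\<lambda>\<omega>. N (G \<omega>)) \<le> (sqrt n + sqrt k) * (c0 + e)" if e: "e > 0" for e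
  proof -
    obtain f :: "real ^ 'k ^ 'n \<Rightarrow> real" where f: "\<And>A B. f (A ** B) \<le> f A * spectral_norm B" "\<And>X Y. \<bar>f X - f Y\<bar> \<le> C * dist X Y"
      "(\<integral>X. f X \<partial>std_gaussian) = (\<integral>X. N X \<partial>std_gaussian)"
      "\<And>X. X \<in> stiefel \<Longrightarrow> f X \<le> c0 + e"
      by (rule averaged_ideal_norm[OF assms(1,7) ideal C(1,3) e, folded c0_def]) (rule that)
    \<comment> \<open>The ideal property moves \<open>R\<close> out of the factorization
      \<open>X = P ** R\<close>, and the averaged function is nearly at most \<open>c0\<close> at
      every \<open>P\<close> in the Stiefel manifold.\<close>
    have le: "f X \<le> (c0 + e) * spectral_norm X" for X
    proof -
      obtain P :: "real ^ 'k ^ 'n" and R :: "real ^ 'k ^ 'k"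
        where PR: "P \<in> stiefel" "X = P ** R" "spectral_norm R = spectral_norm X"
        by (rule stiefel_factorization[OF assms(3)])
      have "f X \<le> f P * spectral_norm X" using f(1)[of P R] PR by simp
      also have "\<dots> \<le> (c0 + e) * spectral_norm X"
        using f(4)[OF PR(1)] by (rule mult_right_mono) (rule spectral_norm_nonneg)
      finally show ?thesis .
    qed
    have "(\<integral>X. f X \<partial>std_gaussian) \<le> (\<integral>X. (c0 + e) * spectral_norm X \<partial>(std_gaussian :: (real ^ 'k ^ 'n) measure))"
    proof (rule integral_mono)
      show "integrable std_gaussian f"
      proof (rule integrable_std_gaussian_linear_growth)
        show "f \<in> borel_measurable borel" using f(2) C(1)
          by (intro borel_measurable_continuous_onI Lipschitz_continuous_on[of C]) auto
        show "\<bar>f X\<bar> \<le> \<bar>f 0\<bar> + C * norm X" for X using f(2)[of X 0] by simp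
      qed (use C in simp)
    qed (auto intro: le spectral_norm_integrable)
    also have "\<dots> = (c0 + e) * (\<integral>X. spectral_norm X \<partial>(std_gaussian :: (real ^ 'k ^ 'n) measure))"
      by simp
    also have "\<dots> \<le> (c0 + e) * (sqrt n + sqrt k)"
    proof (rule mult_left_mono)
      \<comment> \<open>The sign matters because Chevet's bound is multiplied by
        \<open>c0 + e\<close>.\<close>
      have "0 \<le> c0" unfolding c0_def using seminorm_nonneg[of N, OF tri hom] by simp
      then show "0 \<le> c0 + e" using e by simp
    qed (simp add: n_def k_def chevet_spectral_norm)
    finally show ?thesis by (simp add: f(3) gauss mult.commute)
  qed
  \<comment> \<open>The function \<open>f\<close> depended on \<open>e\<close> but the two sides of
    \<open>bound\<close> do not involve it, so \<open>e\<close> may tend to 0.\<close>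
  have "sqrt n * G.expectation (\<lambda>\<omega>. N (G \<omega>)) \<le> (sqrt n + sqrt k) * (c0 + 0)"
  proof (rule tendsto_lowerbound)
    show "((\<lambda>e. (sqrt n + sqrt k) * (c0 + e)) \<longlongrightarrow> (sqrt n + sqrt k) * (c0 + 0)) (at_right 0)"
      by (intro tendsto_intros)
    show "eventually (\<lambda>e. sqrt n * G.expectation (\<lambda>\<omega>. N (G \<omega>)) \<le> (sqrt n + sqrt k) * (c0 + e)) (at_right 0)"
      unfolding eventually_at_right_field using bound by (intro exI[of _ 1]) auto
  qed simp
  also have "sqrt k = sqrt n * sqrt \<rho>"
    using assms(6) by (simp add: k_def n_def real_sqrt_mult mult.commute)
  finally have "sqrt n * G.expectation (\<lambda>\<omega>. N (G \<omega>)) \<le> sqrt n * ((1 + sqrt \<rho>) * c0)"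
    by (simp add: algebra_simps)
  then show ?thesis using n by (simp add: c0_def)
qed

end
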